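(* Let $(Q,g)$ be a smooth Riemannian manifold of dimension $n$ and let $\tilde\nabla$ be an affine connection on $Q$ compatible with the metric $g$, with torsion $\tilde T$. Let $\Omega$ be the volume form on $TQ$ given in induced coordinates by $\Omega=\det g\cdot dx^1\wedge\cdots\wedge dx^n\wedge dv^1\wedge\cdots\wedge dv^n$. There exists an invariant volume for the geodesic spray of $\tilde\nabla$ with density of the form $\tau_Q^*\rho$, i.e. a volume form $(\tau_Q^*\rho)\,\Omega$ with $\rho$ a smooth positive function on $Q$, if and only if the $1$-form $\operatorname{tr}\tilde T$ is exact.
   Context: $\tau_Q:TQ\to Q$ is the bundle projection. Write $\tilde\nabla_{\partial_i}\partial_j=\Gamma^k_{ij}\partial_k$. The connection is compatible with $g$ if $\tilde\nabla g=0$. The geodesic spray is the vector field on $TQ$ $$X=v^i\frac{\partial}{\partial x^i}-\Gamma^i_{jk}v^jv^k\frac{\partial}{\partial v^i}.$$ The torsion is $\tilde T=(\Gamma^k_{ij}-\Gamma^k_{ji})\frac{\partial}{\partial x^k}\otimes dx^i\otimes dx^j$ and its trace is the $1$-form $\operatorname{tr}\tilde T=(\Gamma^i_{ki}-\Gamma^i_{ik})\,dx^k$. A volume form $\mu$ on $TQ$ is invariant if $\mathcal{L}_X\mu=0$. $\Omega$ is globally well defined on $TQ$. *)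

theory Defs
  imports "HOL-Analysis.Analysis"
begin

section \<open>Smooth maps on open subsets of a Euclidean space\<close>

primrec Ck_on :: "nat \<Rightarrow> ('a::euclidean_space \<Rightarrow> 'b::real_normed_vector) \<Rightarrow> 'a set \<Rightarrow> bool" where
  "Ck_on 0 f S \<longleftrightarrow> continuous_on S f"
| "Ck_on (Suc k) f S \<longleftrightarrow>
     (\<forall>x\<in>S. f differentiable (at x)) \<and>
     (\<forall>b\<in>Basis. Ck_on k (\<lambda>x. frechet_derivative f (at x) b) S)"

definition smooth_on :: "('a::euclidean_space \<Rightarrow> 'b::real_normed_vector) \<Rightarrow> 'a set \<Rightarrow> bool" where
  "smooth_on f S \<longleftrightarrow> open S \<and> (\<forall>k. Ck_on k f S)"


section \<open>Smooth manifolds\<close>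

text \<open>A chart is a pair of its domain and its coordinate map; values of the coordinate map
  outside the domain are irrelevant.\<close>

type_synonym ('p, 'e) chart = "'p set \<times> ('p \<Rightarrow> 'e)"

abbreviation cdom :: "('p, 'e) chart \<Rightarrow> 'p set" where "cdom c \<equiv> fst c"
abbreviation coords :: "('p, 'e) chart \<Rightarrow> 'p \<Rightarrow> 'e" where "coords c \<equiv> snd c"

definition cinv :: "('p, 'e) chart \<Rightarrow> 'e \<Rightarrow> 'p" where
  "cinv c = inv_into (cdom c) (coords c)"

definition transition :: "('p, 'e) chart \<Rightarrow> ('p, 'e) chart \<Rightarrow> 'e \<Rightarrow> 'e" where
  "transition c d = coords d \<circ> cinv c"

text \<open>The atlas of a manifold need not be maximal.\<close>

record ('p, 'e) manifold =
  mtop :: "'p topology"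
  atlas :: "('p, 'e) chart set"

definition smooth_manifold :: "('p, 'e::euclidean_space) manifold \<Rightarrow> bool" where
  "smooth_manifold M \<longleftrightarrow>
     Hausdorff_space (mtop M) \<and> second_countable (mtop M) \<and>
     (\<Union>c\<in>atlas M. cdom c) = topspace (mtop M) \<and>
     (\<forall>c\<in>atlas M. openin (mtop M) (cdom c) \<and> open (coords c ` cdom c) \<and>
        homeomorphic_map (subtopology (mtop M) (cdom c)) (top_of_set (coords c ` cdom c)) (coords c)) \<and>
     (\<forall>c\<in>atlas M. \<forall>d\<in>atlas M. smooth_on (transition c d) (coords c ` (cdom c \<inter> cdom d)))"

definition smooth_fun :: "('p, 'e::euclidean_space) manifold \<Rightarrow> 'p set \<Rightarrow> ('p \<Rightarrow> real) \<Rightarrow> bool" where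
  "smooth_fun M U f \<longleftrightarrow> (\<forall>c\<in>atlas M. smooth_on (f \<circ> cinv c) (coords c ` (cdom c \<inter> U)))"


section \<open>Tangent vectors and vector fields\<close>

text \<open>A tangent vector at \<open>p\<close> is the family of its coordinate vectors in all charts of the atlas
  around \<open>p\<close> (and \<open>0\<close> at the remaining indices), related by the Jacobians of the transition maps.
  The vector space operations are those of families.\<close>

type_synonym ('p, 'e) tvec = "('p, 'e) chart \<Rightarrow> 'e"

definition tangent_space :: "('p, 'e::euclidean_space) manifold \<Rightarrow> 'p \<Rightarrow> ('p, 'e) tvec set" where
  "tangent_space M p =
     {v. (\<forall>c\<in>atlas M. \<forall>d\<in>atlas M. p \<in> cdom c \<inter> cdom d \<longrightarrow>
            v d = frechet_derivative (transition c d) (at (coords c p)) (v c)) \<and>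
         (\<forall>c. \<not> (c \<in> atlas M \<and> p \<in> cdom c) \<longrightarrow> v c = 0)}"

text \<open>The tangent vector at \<open>p\<close> whose coordinate vector in the chart \<open>c\<close> is \<open>w\<close>.\<close>

definition tangent_of ::
    "('p, 'e::euclidean_space) manifold \<Rightarrow> ('p, 'e) chart \<Rightarrow> 'p \<Rightarrow> 'e \<Rightarrow> ('p, 'e) tvec" where
  "tangent_of M c p w =
     (\<lambda>d. if d \<in> atlas M \<and> p \<in> cdom d
          then frechet_derivative (transition c d) (at (coords c p)) w else 0)"

type_synonym ('p, 'e) vfield = "'p \<Rightarrow> ('p, 'e) tvec"

text \<open>Smooth vector fields on an open set \<open>U\<close>; the values outside \<open>U\<close> are irrelevant.\<close>

definition vector_field ::
    "('p, 'e::euclidean_space) manifold \<Rightarrow> 'p set \<Rightarrow> ('p, 'e) vfield \<Rightarrow> bool" where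
  "vector_field M U X \<longleftrightarrow>
     (\<forall>p\<in>U. X p \<in> tangent_space M p) \<and>
     (\<forall>c\<in>atlas M. smooth_on (\<lambda>y. X (cinv c y) c) (coords c ` (cdom c \<inter> U)))"

text \<open>The differential \<open>df\<^sub>p(v)\<close>, computed in the chart \<open>c\<close>.\<close>

definition diff_in ::
    "('p, 'e::euclidean_space) chart \<Rightarrow> ('p \<Rightarrow> real) \<Rightarrow> 'p \<Rightarrow> ('p, 'e) tvec \<Rightarrow> real" where
  "diff_in c f p v = frechet_derivative (f \<circ> cinv c) (at (coords c p)) (v c)"

definition coord_field ::
    "('p, real^'n) manifold \<Rightarrow> ('p, real^'n) chart \<Rightarrow> 'n \<Rightarrow> ('p, real^'n) vfield" where
  "coord_field M c i = (\<lambda>p. tangent_of M c p (axis i 1))"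


section \<open>Riemannian metrics and affine connections\<close>

definition riemannian_metric ::
    "('p, 'e::euclidean_space) manifold \<Rightarrow>
     ('p \<Rightarrow> ('p, 'e) tvec \<Rightarrow> ('p, 'e) tvec \<Rightarrow> real) \<Rightarrow> bool" where
  "riemannian_metric M g \<longleftrightarrow>
     (\<forall>p\<in>topspace (mtop M). \<forall>u\<in>tangent_space M p. \<forall>v\<in>tangent_space M p.
        g p u v = g p v u \<and>
        (\<forall>a. \<forall>w\<in>tangent_space M p. g p (\<lambda>c. a *\<^sub>R u c + v c) w = a * g p u w + g p v w) \<and>
        (u \<noteq> (\<lambda>c. 0) \<longrightarrow> g p u u > 0)) \<and>
     (\<forall>c\<in>atlas M. \<forall>b b'. smooth_on
        (\<lambda>y. g (cinv c y) (tangent_of M c (cinv c y) b) (tangent_of M c (cinv c y) b'))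
        (coords c ` cdom c))"

text \<open>\<open>D U X Y\<close> is \<open>\<nabla>\<^sub>X Y\<close> for vector fields \<open>X\<close>, \<open>Y\<close> on the open set \<open>U\<close>.  The connection is
  taken on local vector fields from the start, compatibly with restriction, so that it
  can be applied to the coordinate fields of a chart.\<close>

type_synonym ('p, 'e) connection =
  "'p set \<Rightarrow> ('p, 'e) vfield \<Rightarrow> ('p, 'e) vfield \<Rightarrow> ('p, 'e) vfield"

definition affine_connection ::
    "('p, 'e::euclidean_space) manifold \<Rightarrow> ('p, 'e) connection \<Rightarrow> bool" where
  "affine_connection M D \<longleftrightarrow>
     (\<forall>U X Y. openin (mtop M) U \<and> vector_field M U X \<and> vector_field M U Y \<longrightarrow>
        vector_field M U (D U X Y)) \<and>
     (\<forall>U f X X' Y. openin (mtop M) U \<and> smooth_fun M U f \<and>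
        vector_field M U X \<and> vector_field M U X' \<and> vector_field M U Y \<longrightarrow>
        (\<forall>p\<in>U. \<forall>c. D U (\<lambda>q d. f q *\<^sub>R X q d + X' q d) Y p c = f p *\<^sub>R D U X Y p c + D U X' Y p c)) \<and>
     (\<forall>U X Y Y'. openin (mtop M) U \<and>
        vector_field M U X \<and> vector_field M U Y \<and> vector_field M U Y' \<longrightarrow>
        (\<forall>p\<in>U. \<forall>c. D U X (\<lambda>q d. Y q d + Y' q d) p c = D U X Y p c + D U X Y' p c)) \<and>
     (\<forall>U f X Y. openin (mtop M) U \<and> smooth_fun M U f \<and>
        vector_field M U X \<and> vector_field M U Y \<longrightarrow>
        (\<forall>c\<in>atlas M. \<forall>p\<in>U \<inter> cdom c.
           D U X (\<lambda>q d. f q *\<^sub>R Y q d) p c = f p *\<^sub>R D U X Y p c + diff_in c f p (X p) *\<^sub>R Y p c)) \<and>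
     (\<forall>U V X X' Y Y'. openin (mtop M) U \<and> openin (mtop M) V \<and> V \<subseteq> U \<and>
        vector_field M U X \<and> vector_field M U Y \<and>
        (\<forall>p\<in>V. X' p = X p \<and> Y' p = Y p) \<longrightarrow>
        (\<forall>p\<in>V. D V X' Y' p = D U X Y p))"

text \<open>\<open>(\<nabla>\<^sub>X g)(Y, Z)\<close> at \<open>p\<close>, for vector fields on \<open>U\<close>.\<close>

definition nabla_metric ::
    "('p \<Rightarrow> ('p, 'e) tvec \<Rightarrow> ('p, 'e) tvec \<Rightarrow> real) \<Rightarrow> ('p, 'e::euclidean_space) connection \<Rightarrow>
     'p set \<Rightarrow> ('p, 'e) chart \<Rightarrow> ('p, 'e) vfield \<Rightarrow> ('p, 'e) vfield \<Rightarrow> ('p, 'e) vfield \<Rightarrow> 'p \<Rightarrow> real" where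
  "nabla_metric g D U c X Y Z p =
     diff_in c (\<lambda>q. g q (Y q) (Z q)) p (X p) - g p (D U X Y p) (Z p) - g p (Y p) (D U X Z p)"

definition metric_compatible ::
    "('p, 'e::euclidean_space) manifold \<Rightarrow>
     ('p \<Rightarrow> ('p, 'e) tvec \<Rightarrow> ('p, 'e) tvec \<Rightarrow> real) \<Rightarrow> ('p, 'e) connection \<Rightarrow> bool" where
  "metric_compatible M g D \<longleftrightarrow>
     (\<forall>U X Y Z. openin (mtop M) U \<and>
        vector_field M U X \<and> vector_field M U Y \<and> vector_field M U Z \<longrightarrow>
        (\<forall>c\<in>atlas M. \<forall>p\<in>U \<inter> cdom c. nabla_metric g D U c X Y Z p = 0))"

text \<open>\<open>christoffel M D c k i j\<close> is \<open>\<Gamma>\<^sup>k\<^sub>i\<^sub>j\<close> in the chart \<open>c\<close>: the \<open>k\<close>-th component of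
  \<open>\<nabla>\<^bsub>\<partial>i\<^esub> \<partial>j\<close>.\<close>

definition christoffel ::
    "('p, real^'n) manifold \<Rightarrow> ('p, real^'n) connection \<Rightarrow> ('p, real^'n) chart \<Rightarrow>
     'n \<Rightarrow> 'n \<Rightarrow> 'n \<Rightarrow> 'p \<Rightarrow> real" where
  "christoffel M D c k i j p = D (cdom c) (coord_field M c i) (coord_field M c j) p c $ k"

definition torsion ::
    "('p, real^'n) manifold \<Rightarrow> ('p, real^'n) connection \<Rightarrow> ('p, real^'n) chart \<Rightarrow>
     'n \<Rightarrow> 'n \<Rightarrow> 'n \<Rightarrow> 'p \<Rightarrow> real" where
  "torsion M D c k i j p = christoffel M D c k i j p - christoffel M D c k j i p"

text \<open>One-forms on a manifold modelled on \<open>\<real>\<^sup>n\<close> are given by their coordinate covectors in the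
  charts of the atlas.\<close>

definition torsion_trace ::
    "('p, real^'n) manifold \<Rightarrow> ('p, real^'n) connection \<Rightarrow> ('p, real^'n) chart \<Rightarrow> 'p \<Rightarrow> real^'n" where
  "torsion_trace M D c p = (\<chi> k. \<Sum>i\<in>UNIV. torsion M D c i k i p)"

definition exact_one_form ::
    "('p, real^'n) manifold \<Rightarrow> (('p, real^'n) chart \<Rightarrow> 'p \<Rightarrow> real^'n) \<Rightarrow> bool" where
  "exact_one_form M \<theta> \<longleftrightarrow>
     (\<exists>f. smooth_fun M (topspace (mtop M)) f \<and>
        (\<forall>c\<in>atlas M. \<forall>p\<in>cdom c. \<forall>v\<in>tangent_space M p.
           diff_in c f p v = (\<Sum>k\<in>UNIV. \<theta> c p $ k * v c $ k)))"


section \<open>Volume forms and Lie derivatives\<close>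

text \<open>A form of degree \<open>card (UNIV :: 'k set)\<close> takes a family of tangent vectors indexed by \<open>'k\<close>.\<close>

type_synonym ('p, 'e, 'k) dform = "'p \<Rightarrow> ('k \<Rightarrow> ('p, 'e) tvec) \<Rightarrow> real"

definition form_in ::
    "('p, 'e::euclidean_space) manifold \<Rightarrow> ('p, 'e) chart \<Rightarrow> ('p, 'e, 'k) dform \<Rightarrow>
     'e \<Rightarrow> ('k \<Rightarrow> 'e) \<Rightarrow> real" where
  "form_in M c \<omega> y b = \<omega> (cinv c y) (\<lambda>i. tangent_of M c (cinv c y) (b i))"

definition differential_form ::
    "('p, 'e::euclidean_space) manifold \<Rightarrow> ('p, 'e, 'k::finite) dform \<Rightarrow> bool" where
  "differential_form M \<omega> \<longleftrightarrow>
     (\<forall>p\<in>topspace (mtop M). \<forall>ws. (\<forall>i. ws i \<in> tangent_space M p) \<longrightarrow>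
        (\<forall>i a. \<forall>u\<in>tangent_space M p. \<forall>v\<in>tangent_space M p.
           \<omega> p (ws(i := \<lambda>c. a *\<^sub>R u c + v c)) = a * \<omega> p (ws(i := u)) + \<omega> p (ws(i := v))) \<and>
        (\<forall>i j. i \<noteq> j \<and> ws i = ws j \<longrightarrow> \<omega> p ws = 0)) \<and>
     (\<forall>c\<in>atlas M. \<forall>b. smooth_on (\<lambda>y. form_in M c \<omega> y b) (coords c ` cdom c))"

definition volume_form ::
    "('p, 'e::euclidean_space) manifold \<Rightarrow> ('p, 'e, 'k::finite) dform \<Rightarrow> bool" where
  "volume_form M \<omega> \<longleftrightarrow>
     CARD('k) = DIM('e) \<and> differential_form M \<omega> \<and>
     (\<forall>p\<in>topspace (mtop M). \<exists>ws. (\<forall>i. ws i \<in> tangent_space M p) \<and> \<omega> p ws \<noteq> 0)"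

text \<open>The Lie derivative of a form in the coordinates of the chart \<open>c\<close>,
  \<open>(L\<^sub>X \<omega>)(b\<^sub>1, \<dots>, b\<^sub>k) = X(\<omega>(b\<^sub>1, \<dots>, b\<^sub>k)) - (\<Sum>i. \<omega>(b\<^sub>1, \<dots>, [X, b\<^sub>i], \<dots>, b\<^sub>k))\<close>
  for fields \<open>b\<^sub>i\<close> with constant coordinate vectors, for which \<open>[X, b\<^sub>i] = - DX(b\<^sub>i)\<close>.\<close>

definition lie_derivative ::
    "('p, 'e::euclidean_space) manifold \<Rightarrow> ('p, 'e) chart \<Rightarrow> ('p, 'e) vfield \<Rightarrow>
     ('p, 'e, 'k::finite) dform \<Rightarrow> ('p, 'e, 'k) dform" where
  "lie_derivative M c X \<omega> p ws =
     (let y = coords c p; b = (\<lambda>i. ws i c); Xc = (\<lambda>z. X (cinv c z) c) in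
        frechet_derivative (\<lambda>z. form_in M c \<omega> z b) (at y) (Xc y) +
        (\<Sum>i\<in>UNIV. form_in M c \<omega> y (b(i := frechet_derivative Xc (at y) (b i)))))"

definition invariant_volume ::
    "('p, 'e::euclidean_space) manifold \<Rightarrow> ('p, 'e) vfield \<Rightarrow> ('p, 'e, 'k::finite) dform \<Rightarrow> bool" where
  "invariant_volume M X \<mu> \<longleftrightarrow>
     volume_form M \<mu> \<and>
     (\<forall>c\<in>atlas M. \<forall>p\<in>cdom c. \<forall>ws. (\<forall>i. ws i \<in> tangent_space M p) \<longrightarrow>
        lie_derivative M c X \<mu> p ws = 0)"


section \<open>The tangent bundle, the geodesic spray and the form \<open>\<Omega>\<close>\<close>

type_synonym ('p, 'e) tpoint = "'p \<times> ('p, 'e) tvec"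

text \<open>The chart of the tangent bundle induced by \<open>c\<close>, with coordinates \<open>(x, v)\<close>.\<close>

definition tangent_chart ::
    "('p, 'e::euclidean_space) manifold \<Rightarrow> ('p, 'e) chart \<Rightarrow> (('p, 'e) tpoint, 'e \<times> 'e) chart" where
  "tangent_chart M c =
     ({(p, v). p \<in> cdom c \<and> v \<in> tangent_space M p}, \<lambda>(p, v). (coords c p, v c))"

definition tangent_bundle ::
    "('p, 'e::euclidean_space) manifold \<Rightarrow> (('p, 'e) tpoint, 'e \<times> 'e) manifold" where
  "tangent_bundle M =
     \<lparr> mtop = topology (\<lambda>W. W \<subseteq> {(p, v). p \<in> topspace (mtop M) \<and> v \<in> tangent_space M p} \<and>
         (\<forall>c\<in>atlas M. open (coords (tangent_chart M c) ` (cdom (tangent_chart M c) \<inter> W)))),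
       atlas = tangent_chart M ` atlas M \<rparr>"

definition bundle_proj :: "('p, 'e) tpoint \<Rightarrow> 'p" where
  "bundle_proj = fst"

text \<open>\<open>X = v\<^sup>i \<partial>/\<partial>x\<^sup>i - \<Gamma>\<^sup>i\<^sub>j\<^sub>k v\<^sup>j v\<^sup>k \<partial>/\<partial>v\<^sup>i\<close> in all induced coordinates.\<close>

definition geodesic_spray ::
    "('p, real^'n) manifold \<Rightarrow> ('p, real^'n) connection \<Rightarrow>
     (('p, real^'n) tpoint, (real^'n) \<times> (real^'n)) vfield \<Rightarrow> bool" where
  "geodesic_spray M D X \<longleftrightarrow>
     vector_field (tangent_bundle M) (topspace (mtop (tangent_bundle M))) X \<and>
     (\<forall>c\<in>atlas M. \<forall>(p, v)\<in>cdom (tangent_chart M c).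
        X (p, v) (tangent_chart M c) =
          (v c, \<chi> i. - (\<Sum>j\<in>UNIV. \<Sum>k\<in>UNIV. christoffel M D c i j k p * v c $ j * v c $ k)))"

definition metric_matrix ::
    "('p, real^'n) manifold \<Rightarrow>
     ('p \<Rightarrow> ('p, real^'n) tvec \<Rightarrow> ('p, real^'n) tvec \<Rightarrow> real) \<Rightarrow>
     ('p, real^'n) chart \<Rightarrow> 'p \<Rightarrow> real^'n^'n" where
  "metric_matrix M g c p = (\<chi> i j. g p (coord_field M c i p) (coord_field M c j p))"

text \<open>The coordinate one-forms \<open>dx\<^sup>i\<close> (index \<open>Inl i\<close>) and \<open>dv\<^sup>i\<close> (index \<open>Inr i\<close>), applied to the
  coordinate vector of a tangent vector of the tangent bundle.\<close>

fun coord_covector :: "'n + 'n \<Rightarrow> (real^'n) \<times> (real^'n) \<Rightarrow> real" where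
  "coord_covector (Inl i) w = fst w $ i"
| "coord_covector (Inr i) w = snd w $ i"

text \<open>\<open>\<Omega> = det g \<cdot> dx\<^sup>1 \<and> \<dots> \<and> dx\<^sup>n \<and> dv\<^sup>1 \<and> \<dots> \<and> dv\<^sup>n\<close> in all induced coordinates, where
  \<open>(\<alpha>\<^sup>1 \<and> \<dots> \<and> \<alpha>\<^sup>m)(w\<^sub>1, \<dots>, w\<^sub>m) = det (\<alpha>\<^sup>a(w\<^sub>b))\<close>.  Since arguments and covectors share the index
  type \<open>'n + 'n\<close>, the determinant does not depend on an ordering of the indices.\<close>

definition metric_volume ::
    "('p, real^'n) manifold \<Rightarrow>
     ('p \<Rightarrow> ('p, real^'n) tvec \<Rightarrow> ('p, real^'n) tvec \<Rightarrow> real) \<Rightarrow>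
     (('p, real^'n) tpoint, (real^'n) \<times> (real^'n), 'n::finite + 'n) dform \<Rightarrow> bool" where
  "metric_volume M g \<Omega> \<longleftrightarrow>
     volume_form (tangent_bundle M) \<Omega> \<and>
     (\<forall>c\<in>atlas M. \<forall>q\<in>cdom (tangent_chart M c).
        \<forall>ws. (\<forall>b. ws b \<in> tangent_space (tangent_bundle M) q) \<longrightarrow>
          \<Omega> q ws = det (metric_matrix M g c (bundle_proj q)) *
            det (\<chi> a b. coord_covector a (ws b (tangent_chart M c))))"

end

theory Submission
  imports Defs
begin

text \<open>In induced coordinates the form \<open>\<rho> \<Omega>\<close> is \<open>h dx \<and> dv\<close>, where \<open>h = \<rho> det g\<close> is a function of the base
  point.  Its Lie derivative along the spray \<open>X\<close> is therefore \<open>(dh(v) + h div X) dx \<and> dv\<close>.  The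
  horizontal part of \<open>X\<close> is \<open>v\<close> and its vertical part is quadratic in \<open>v\<close>, so
  \<open>div X = - (\<Gamma>\<^sup>i\<^sub>i\<^sub>k + \<Gamma>\<^sup>i\<^sub>k\<^sub>i) v\<^sup>k\<close> (\<open>spray_divergence\<close>).  Compatibility of the connection expresses the
  derivatives of the metric by the Christoffel symbols, and Jacobi's formula gives
  \<open>\<partial>\<^sub>k det g = 2 \<Gamma>\<^sup>i\<^sub>k\<^sub>i det g\<close> (\<open>det_metric_has_derivative\<close>).  Altogether the terms in \<open>\<Gamma>\<close> combine to
  \<open>(\<Gamma>\<^sup>i\<^sub>k\<^sub>i - \<Gamma>\<^sup>i\<^sub>i\<^sub>k) v\<^sup>k\<close>, which is the trace of the torsion, and the Lie derivative of \<open>\<rho> \<Omega>\<close> at \<open>(p, v)\<close> is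
  \<open>(d\<rho> + \<rho> tr T)(v) \<Omega>\<close> (\<open>lie_derivative_weighted_metric_volume\<close>).

  As \<open>\<Omega>\<close> vanishes nowhere and \<open>v\<close> is arbitrary, the form is invariant if and only if
  \<open>d\<rho> = - \<rho> tr T\<close> (\<open>invariant_iff_torsion_trace\<close>).  For positive \<open>\<rho>\<close> this says that \<open>tr T\<close> is the
  differential of \<open>- ln \<rho>\<close>; conversely, \<open>exp (- f)\<close> is such a density if \<open>df = tr T\<close>.

  To compute in coordinates, one has to know that every coordinate vector belongs to a tangent
  vector of the manifold, which is the chain rule for transition maps.  It is needed both on the
  base and on the tangent bundle, and is proved for both at once from \<open>diff_atlas\<close>.\<close>

section \<open>Calculus of smooth maps\<close>

lemma Ck_on_cong:
  assumes "open S" "\<And>x. x \<in> S \<Longrightarrow> f x = g x" "Ck_on k f S"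
  shows "Ck_on k g S"
  using assms(2,3)
proof (induction k arbitrary: f g)
  case 0
  then show ?case
    using continuous_on_cong[of S S f g] by simp
next
  case (Suc k)
  have der: "(g has_derivative frechet_derivative f (at x)) (at x)" if "x \<in> S" for x
    using that Suc.prems
    by (intro has_derivative_transform_within_open[OF iffD1[OF frechet_derivative_works] \<open>open S\<close> that])
       auto
  have eq: "frechet_derivative f (at x) = frechet_derivative g (at x)" if "x \<in> S" for x
    using frechet_derivative_at[OF der[OF that]] by simp
  have "Ck_on k (\<lambda>x. frechet_derivative g (at x) b) S" if "b \<in> Basis" for b
    by (rule Suc.IH[of "\<lambda>x. frechet_derivative f (at x) b"]) (use that Suc.prems eq in auto)
  then show ?case
    using der by (auto simp: differentiable_def)
qed

lemma Ck_on_lower: "Ck_on (Suc k) f S \<Longrightarrow> Ck_on k f S"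
proof (induction k arbitrary: f)
  case 0
  then show ?case
    by (auto intro!: continuous_at_imp_continuous_on differentiable_imp_continuous_within)
next
  case (Suc k)
  then show ?case
    by (auto simp del: Ck_on.simps simp: Ck_on.simps(2)[of "Suc k"] Ck_on.simps(2)[of k f])
qed

text \<open>Introduces differentiability and the partial derivatives together, from any explicit formula
  for the derivative; all closure properties below go through it.\<close>

lemma Ck_on_Suc_I:
  assumes "open S" "\<And>x. x \<in> S \<Longrightarrow> (f has_derivative F x) (at x)"
    and "\<And>b. b \<in> Basis \<Longrightarrow> Ck_on k (\<lambda>x. F x b) S"
  shows "Ck_on (Suc k) f S"
proof -
  have "F x = frechet_derivative f (at x)" if "x \<in> S" for x
    using frechet_derivative_at[OF assms(2)[OF that]] .
  then have "Ck_on k (\<lambda>x. frechet_derivative f (at x) b) S" if "b \<in> Basis" for b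
    by (intro Ck_on_cong[OF \<open>open S\<close> _ assms(3)[OF that]]) simp
  then show ?thesis
    using assms(2) by (auto simp: differentiable_def)
qed

lemma Ck_on_const: "open S \<Longrightarrow> Ck_on k (\<lambda>x. c) S"
proof (induction k arbitrary: c)
  case (Suc k)
  then show ?case
    by (intro Ck_on_Suc_I[where F = "\<lambda>x b. 0"] has_derivative_const) auto
qed simp

lemma Ck_on_ident: "open S \<Longrightarrow> Ck_on k (\<lambda>x. x) S"
proof (cases k)
  case (Suc l)
  assume "open S"
  then show ?thesis unfolding Suc
    by (intro Ck_on_Suc_I[where F = "\<lambda>x b. b"] has_derivative_ident Ck_on_const)
qed simp

lemma Ck_on_linear:
  assumes "bounded_linear h" "open S" "Ck_on k f S"
  shows "Ck_on k (\<lambda>x. h (f x)) S"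
  using assms(3)
proof (induction k arbitrary: f)
  case 0
  then show ?case
    using bounded_linear.continuous_on[OF assms(1)] by auto
next
  case (Suc k)
  then show ?case
    by (intro Ck_on_Suc_I[where F = "\<lambda>x b. h (frechet_derivative f (at x) b)"] \<open>open S\<close>
        bounded_linear.has_derivative[OF assms(1)]) (auto simp: frechet_derivative_works)
qed

lemma Ck_on_add:
  assumes "open S" "Ck_on k f S" "Ck_on k g S"
  shows "Ck_on k (\<lambda>x. f x + g x) S"
  using assms(2,3)
proof (induction k arbitrary: f g)
  case 0
  then show ?case by (auto intro: continuous_on_add)
next
  case (Suc k)
  then show ?case
    by (intro Ck_on_Suc_I[where F = "\<lambda>x b. frechet_derivative f (at x) b
          + frechet_derivative g (at x) b"] \<open>open S\<close> has_derivative_add)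
       (auto simp: frechet_derivative_works)
qed

lemma Ck_on_sum:
  assumes "open S" "\<And>i. i \<in> I \<Longrightarrow> Ck_on k (f i) S"
  shows "Ck_on k (\<lambda>x. \<Sum>i\<in>I. f i x) S"
  using assms(2)
  by (induction I rule: infinite_finite_induct) (auto intro: Ck_on_const Ck_on_add assms(1))

lemma Ck_on_bilinear:
  assumes "bounded_bilinear B" "open S" "Ck_on k f S" "Ck_on k g S"
  shows "Ck_on k (\<lambda>x. B (f x) (g x)) S"
  using assms(3,4)
proof (induction k arbitrary: f g)
  case 0
  then show ?case
    using bounded_bilinear.continuous_on[OF assms(1)] by auto
next
  case (Suc k)
  have low: "Ck_on k f S" "Ck_on k g S"
    using Suc.prems by (auto intro: Ck_on_lower simp del: Ck_on.simps)
  show ?case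
  proof (rule Ck_on_Suc_I[where F = "\<lambda>x b. B (f x) (frechet_derivative g (at x) b)
          + B (frechet_derivative f (at x) b) (g x)"])
    show "((\<lambda>x. B (f x) (g x)) has_derivative (\<lambda>b. B (f x) (frechet_derivative g (at x) b)
          + B (frechet_derivative f (at x) b) (g x))) (at x)" if "x \<in> S" for x
      using that Suc.prems
      by (intro bounded_bilinear.FDERIV[OF assms(1)]) (auto simp: frechet_derivative_works)
  qed (use Suc low assms(2) in \<open>auto intro!: Ck_on_add\<close>)
qed

text \<open>The partial derivatives of the composition are, by the chain rule, sums of products of partial
  derivatives of \<open>g\<close> with partial derivatives of \<open>f\<close> composed with \<open>g\<close>.  The induction therefore
  varies \<open>f\<close> and keeps \<open>g\<close>, at a lower order of differentiability.\<close>

lemma Ck_on_compose: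
  fixes f :: "'b::euclidean_space \<Rightarrow> 'c::real_normed_vector" and g :: "'a::euclidean_space \<Rightarrow> 'b"
  assumes "open S" "open T" "Ck_on k f T" "Ck_on k g S" "g ` S \<subseteq> T"
  shows "Ck_on k (\<lambda>x. f (g x)) S"
  using assms(3,4)
proof (induction k arbitrary: f)
  case 0
  then show ?case
    using continuous_on_compose2[of T f S g] assms(5) by auto
next
  case (Suc k)
  have low: "Ck_on k g S"
    using Suc.prems by (auto intro: Ck_on_lower simp del: Ck_on.simps)
  define F where "F = (\<lambda>x b. \<Sum>e\<in>Basis. (frechet_derivative g (at x) b \<bullet> e) *\<^sub>R
    frechet_derivative f (at (g x)) e)"
  show ?case
  proof (rule Ck_on_Suc_I[where F = F])
    fix x assume x: "x \<in> S"
    have f: "(f has_derivative frechet_derivative f (at (g x))) (at (g x))"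
      and g: "(g has_derivative frechet_derivative g (at x)) (at x)"
      using Suc.prems x assms(5) by (auto simp: frechet_derivative_works)
    interpret f': linear "frechet_derivative f (at (g x))"
      using f by (rule has_derivative_linear)
    have "F x = (\<lambda>b. frechet_derivative f (at (g x)) (frechet_derivative g (at x) b))"
      unfolding F_def
      by (intro ext) (simp flip: f'.scale f'.sum add: euclidean_representation)
    then show "((\<lambda>x. f (g x)) has_derivative F x) (at x)"
      using has_derivative_compose[OF g f] by simp
  next
    fix b :: 'a assume b: "b \<in> Basis"
    have "Ck_on k (\<lambda>x. frechet_derivative f (at (g x)) e) S" if "e \<in> Basis" for e
      using that Suc.prems low by (intro Suc.IH) auto
    moreover have "Ck_on k (\<lambda>x. frechet_derivative g (at x) b \<bullet> e) S" for e
      using b Suc.prems by (intro Ck_on_linear[OF bounded_linear_inner_left] \<open>open S\<close>) auto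
    ultimately show "Ck_on k (\<lambda>x. F x b) S"
      unfolding F_def
      by (intro Ck_on_sum Ck_on_bilinear[OF bounded_bilinear_scaleR] \<open>open S\<close>)
  qed (fact \<open>open S\<close>)
qed

lemma smooth_on_open: "smooth_on f S \<Longrightarrow> open S"
  by (simp add: smooth_on_def)

lemma smooth_on_differentiable: "smooth_on f S \<Longrightarrow> x \<in> S \<Longrightarrow> f differentiable (at x)"
  unfolding smooth_on_def by (metis Ck_on.simps(2))

lemma smooth_on_cong: "smooth_on f S \<Longrightarrow> (\<And>x. x \<in> S \<Longrightarrow> f x = g x) \<Longrightarrow> smooth_on g S"
  unfolding smooth_on_def using Ck_on_cong[of S f g] by auto

lemma smooth_on_mult:
  fixes f g :: "'a::euclidean_space \<Rightarrow> real"
  shows "smooth_on f S \<Longrightarrow> smooth_on g S \<Longrightarrow> smooth_on (\<lambda>x. f x * g x) S"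
  unfolding smooth_on_def using Ck_on_bilinear[OF bounded_bilinear_mult] by blast

lemma smooth_on_linear:
  "bounded_linear h \<Longrightarrow> smooth_on f S \<Longrightarrow> smooth_on (\<lambda>x. h (f x)) S"
  unfolding smooth_on_def using Ck_on_linear by blast

lemma smooth_on_compose:
  "smooth_on f T \<Longrightarrow> smooth_on g S \<Longrightarrow> g ` S \<subseteq> T \<Longrightarrow> smooth_on (\<lambda>x. f (g x)) S"
  unfolding smooth_on_def using Ck_on_compose by blast

lemma smooth_on_partial:
  "smooth_on f S \<Longrightarrow> b \<in> Basis \<Longrightarrow> smooth_on (\<lambda>x. frechet_derivative f (at x) b) S"
  unfolding smooth_on_def by (metis Ck_on.simps(2))

lemma smooth_on_exp: "smooth_on (exp :: real \<Rightarrow> real) UNIV"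
proof -
  have "Ck_on k (exp :: real \<Rightarrow> real) UNIV" for k
  proof (induction k)
    case (Suc k)
    then show ?case
      by (intro Ck_on_Suc_I[where F = "\<lambda>x b. b * exp x"])
         (auto intro!: derivative_eq_intros simp del: Ck_on.simps)
  qed (simp add: continuous_on_exp)
  then show ?thesis by (simp add: smooth_on_def)
qed

lemma smooth_on_ln: "smooth_on (ln :: real \<Rightarrow> real) {0<..}"
proof -
  have inv: "Ck_on k (inverse :: real \<Rightarrow> real) {0<..}" for k
  proof (induction k)
    case (Suc k)
    have "Ck_on k (\<lambda>x::real. - (inverse x * inverse x)) {0<..}"
      using bounded_linear_minus[OF bounded_linear_ident]
      by (intro Ck_on_linear[of uminus] Ck_on_bilinear[OF bounded_bilinear_mult] Suc.IH) auto
    then show ?case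
      by (intro Ck_on_Suc_I[where F = "\<lambda>x b. - (inverse x * b * inverse x)"])
         (auto intro!: has_derivative_inverse' simp del: Ck_on.simps)
  qed (simp add: continuous_on_inverse)
  have "Ck_on k (ln :: real \<Rightarrow> real) {0<..}" for k
  proof (cases k)
    case (Suc l)
    show ?thesis unfolding Suc
      by (intro Ck_on_Suc_I[where F = "\<lambda>x b. b * inverse x"])
         (auto intro!: derivative_eq_intros inv simp: divide_inverse simp del: Ck_on.simps)
  qed (simp add: continuous_on_ln)
  then show ?thesis by (simp add: smooth_on_def)
qed

lemma smooth_on_fst:
  fixes f :: "'a::euclidean_space \<Rightarrow> 'c::real_normed_vector"
  assumes "smooth_on f S"
  shows "smooth_on (\<lambda>z :: 'a \<times> 'b::euclidean_space. f (fst z)) (S \<times> UNIV)"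
proof (rule smooth_on_compose[OF assms])
  have "open (S \<times> (UNIV :: 'b set))"
    using smooth_on_open[OF assms] by (simp add: open_Times)
  then show "smooth_on fst (S \<times> (UNIV :: 'b set))"
    by (auto simp: smooth_on_def intro: Ck_on_linear[OF bounded_linear_fst] Ck_on_ident)
qed auto


section \<open>Derivatives of determinants\<close>

text \<open>The product rule in the Leibniz formula: each factor of each summand belongs to one row, so
  the terms regroup by the row that is differentiated.\<close>

lemma det_has_derivative:
  fixes A :: "'a::real_normed_vector \<Rightarrow> real^'m^'m"
  assumes "\<And>i j. ((\<lambda>x. A x $ i $ j) has_derivative (\<lambda>h. A' h $ i $ j)) (at x)"
  shows "((\<lambda>x. det (A x)) has_derivative
     (\<lambda>h. \<Sum>i\<in>UNIV. det (\<chi> r s. if r = i then A' h $ r $ s else A x $ r $ s))) (at x)"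
proof -
  have "((\<lambda>x. det (A x)) has_derivative
     (\<lambda>h. \<Sum>p | p permutes UNIV. of_int (sign p) *
        (\<Sum>i\<in>UNIV. A' h $ i $ p i * (\<Prod>j\<in>UNIV - {i}. A x $ j $ p j)))) (at x)"
    unfolding det_def
    by (intro has_derivative_sum has_derivative_mult_right has_derivative_prod assms)
  also have "(\<lambda>h. \<Sum>p | p permutes UNIV. of_int (sign p) *
        (\<Sum>i\<in>UNIV. A' h $ i $ p i * (\<Prod>j\<in>UNIV - {i}. A x $ j $ p j))) =
     (\<lambda>h. \<Sum>i\<in>UNIV. det (\<chi> r s. if r = i then A' h $ r $ s else A x $ r $ s))"
  proof
    fix h
    have prod: "A' h $ i $ p i * (\<Prod>j\<in>UNIV - {i}. A x $ j $ p j) =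
        (\<Prod>r\<in>UNIV. (\<chi> r s. if r = i then A' h $ r $ s else A x $ r $ s) $ r $ p r)" for i p
      by (subst prod.remove[of _ i]) auto
    show "(\<Sum>p | p permutes UNIV. of_int (sign p) *
        (\<Sum>i\<in>UNIV. A' h $ i $ p i * (\<Prod>j\<in>UNIV - {i}. A x $ j $ p j))) =
       (\<Sum>i\<in>UNIV. det (\<chi> r s. if r = i then A' h $ r $ s else A x $ r $ s))"
      unfolding det_def prod sum_distrib_left by (subst sum.swap) simp
  qed
  finally show ?thesis .
qed

text \<open>Both sides are the derivative of \<open>det (A + t *\<^sub>R M)\<close> at \<open>t = 0\<close>, computed once by rows and once,
  after a transposition, by columns.\<close>

lemma sum_det_replace_column:
  fixes A M :: "real^'m^'m"
  shows "(\<Sum>i\<in>UNIV. det (\<chi> r s. if s = i then M $ r $ s else A $ r $ s)) =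
     (\<Sum>i\<in>UNIV. det (\<chi> r s. if r = i then M $ r $ s else A $ r $ s))"
proof -
  have *: "((\<lambda>t::real. det (B + t *\<^sub>R N)) has_derivative
     (\<lambda>h. \<Sum>i\<in>UNIV. det (\<chi> r s. if r = i then (h *\<^sub>R N) $ r $ s else (B + 0 *\<^sub>R N) $ r $ s))) (at 0)"
    for B N :: "real^'m^'m"
    by (rule det_has_derivative) (auto intro!: derivative_eq_intros)
  have tr: "det (A + t *\<^sub>R M) = det (transpose A + t *\<^sub>R transpose M)" for t
  proof -
    have "transpose A + t *\<^sub>R transpose M = transpose (A + t *\<^sub>R M)"
      by (simp add: transpose_def vec_eq_iff)
    then show ?thesis by simp
  qed
  have "(\<Sum>i\<in>UNIV. det (\<chi> r s. if r = i then transpose M $ r $ s else transpose A $ r $ s)) =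
     (\<Sum>i\<in>UNIV. det (\<chi> r s. if r = i then M $ r $ s else A $ r $ s))"
    using fun_cong[OF has_derivative_unique[OF *[of "transpose A" "transpose M"]
      *[of A M, unfolded tr]], of 1] by (simp cong: if_cong)
  moreover have "det (\<chi> r s. if r = i then transpose M $ r $ s else transpose A $ r $ s) =
     det (\<chi> r s. if s = i then M $ r $ s else A $ r $ s)" for i
    by (subst det_transpose[symmetric]) (simp add: transpose_def cong: if_cong)
  ultimately show ?thesis by simp
qed

text \<open>Expand row \<open>i\<close> of \<open>P ** A\<close> as the combination of the rows of \<open>A\<close> with coefficients \<open>P $ i\<close>: every
  term other than that of \<open>A $ i\<close> itself repeats a row.\<close>

lemma sum_det_replace_row_matmul:
  fixes P A :: "real^'m^'m"
  shows "(\<Sum>i\<in>UNIV. det (\<chi> r s. if r = i then (P ** A) $ r $ s else A $ r $ s)) = trace P * det A"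
proof -
  have "det (\<chi> r s. if r = i then (P ** A) $ r $ s else A $ r $ s) = P $ i $ i * det A" for i
  proof -
    have "(\<chi> r s. if r = i then (P ** A) $ r $ s else A $ r $ s) =
        (\<chi> r. if r = i then (\<Sum>l\<in>UNIV. P $ i $ l *s A $ l) else A $ r)"
      by (auto simp: vec_eq_iff matrix_matrix_mult_def)
    then have "det (\<chi> r s. if r = i then (P ** A) $ r $ s else A $ r $ s) =
        (\<Sum>l\<in>UNIV. P $ i $ l * det (\<chi> r. if r = i then A $ l else A $ r))"
      by (simp add: det_linear_row_sum det_row_mul)
    also have "\<dots> = (\<Sum>l\<in>UNIV. if l = i then P $ i $ i * det A else 0)"
    proof (rule sum.cong)
      fix l
      have "det (\<chi> r. if r = i then A $ l else A $ r) = (if l = i then det A else 0)"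
      proof (cases "l = i")
        case True
        then have "(\<chi> r. if r = i then A $ l else A $ r) = A" by (simp add: vec_eq_iff)
        with True show ?thesis by simp
      next
        case False
        then show ?thesis
          by (auto intro!: det_identical_rows[of i l] simp: row_def vec_eq_iff)
      qed
      then show "P $ i $ l * det (\<chi> r. if r = i then A $ l else A $ r) =
          (if l = i then P $ i $ i * det A else 0)" by auto
    qed simp
    finally show ?thesis by simp
  qed
  then show ?thesis
    by (simp add: trace_def sum_distrib_right)
qed

lemma sum_det_replace_row_matmul_right:
  fixes P A :: "real^'m^'m"
  shows "(\<Sum>i\<in>UNIV. det (\<chi> r s. if r = i then (A ** P) $ r $ s else A $ r $ s)) = trace P * det A"
proof -
  have "(\<Sum>i\<in>UNIV. det (\<chi> r s. if r = i then (A ** P) $ r $ s else A $ r $ s)) =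
    (\<Sum>i\<in>UNIV. det (\<chi> r s. if s = i then (A ** P) $ r $ s else A $ r $ s))"
    by (rule sum_det_replace_column[symmetric])
  also have "\<dots> = (\<Sum>i\<in>UNIV. det (\<chi> r s. if r = i then (transpose P ** transpose A) $ r $ s
      else transpose A $ r $ s))"
    by (intro sum.cong refl, subst det_transpose[symmetric], unfold matrix_transpose_mul[symmetric])
       (simp add: transpose_def cong: if_cong)
  also have "\<dots> = trace P * det A"
    unfolding sum_det_replace_row_matmul det_transpose by (simp add: trace_def transpose_def)
  finally show ?thesis .
qed

text \<open>Jacobi's formula for a derivative of the form that metric compatibility gives to the Gram
  matrix.  It is valid at singular matrices too, so that no inverse metric appears.\<close>

lemma det_has_derivative_congruence:
  fixes A :: "'a::real_normed_vector \<Rightarrow> real^'m^'m"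
  assumes "\<And>i j. ((\<lambda>x. A x $ i $ j) has_derivative
      (\<lambda>h. (P h ** A x + A x ** transpose (P h)) $ i $ j)) (at x)"
  shows "((\<lambda>x. det (A x)) has_derivative (\<lambda>h. 2 * trace (P h) * det (A x))) (at x)"
proof -
  have "(\<Sum>i\<in>UNIV. det (\<chi> r s. if r = i then (P h ** A x + A x ** transpose (P h)) $ r $ s
      else A x $ r $ s)) = 2 * trace (P h) * det (A x)" for h
  proof -
    have row: "(\<chi> r s. if r = i then K $ r $ s else A x $ r $ s) = (\<chi> r. if r = i then K $ r else A x $ r)"
      for K i by (simp add: vec_eq_iff)
    have "(\<Sum>i\<in>UNIV. det (\<chi> r s. if r = i then (P h ** A x + A x ** transpose (P h)) $ r $ s
          else A x $ r $ s)) =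
        (\<Sum>i\<in>UNIV. det (\<chi> r s. if r = i then (P h ** A x) $ r $ s else A x $ r $ s)) +
        (\<Sum>i\<in>UNIV. det (\<chi> r s. if r = i then (A x ** transpose (P h)) $ r $ s else A x $ r $ s))"
      unfolding row unfolding vector_add_component det_row_add sum.distrib ..
    also have "\<dots> = 2 * trace (P h) * det (A x)"
      unfolding sum_det_replace_row_matmul sum_det_replace_row_matmul_right
      by (simp add: trace_def transpose_def)
    finally show ?thesis .
  qed
  with det_has_derivative[OF assms] show ?thesis by simp
qed

section \<open>Tangent vectors in charts\<close>

text \<open>The part of the manifold structure on which the calculus of tangent vectors depends.  It is
  shared by a manifold and its tangent bundle; for the latter it is much easier to obtain than
  smoothness of the transition maps.\<close>

definition diff_atlas :: "('p, 'e::euclidean_space) manifold \<Rightarrow> bool" where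
  "diff_atlas M \<longleftrightarrow>
     (\<forall>c\<in>atlas M. inj_on (coords c) (cdom c)) \<and>
     (\<forall>c\<in>atlas M. \<forall>d\<in>atlas M. open (coords c ` (cdom c \<inter> cdom d)) \<and>
        (\<forall>y\<in>coords c ` (cdom c \<inter> cdom d). transition c d differentiable (at y)))"

lemma cinv_coords: "diff_atlas M \<Longrightarrow> c \<in> atlas M \<Longrightarrow> p \<in> cdom c \<Longrightarrow> cinv c (coords c p) = p"
  by (simp add: diff_atlas_def cinv_def)

lemma open_chart_image: "diff_atlas M \<Longrightarrow> c \<in> atlas M \<Longrightarrow> open (coords c ` cdom c)"
  unfolding diff_atlas_def by (metis Int_absorb)

lemma transition_coords:
  "diff_atlas M \<Longrightarrow> c \<in> atlas M \<Longrightarrow> p \<in> cdom c \<Longrightarrow> transition c d (coords c p) = coords d p"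
  by (simp add: transition_def cinv_coords)

lemma transition_has_derivative:
  assumes "diff_atlas M" "c \<in> atlas M" "d \<in> atlas M" "p \<in> cdom c" "p \<in> cdom d"
  shows "(transition c d has_derivative frechet_derivative (transition c d) (at (coords c p)))
    (at (coords c p))"
  using assms unfolding diff_atlas_def by (auto simp: frechet_derivative_works)

lemma transition_derivative_linear:
  assumes "diff_atlas M" "c \<in> atlas M" "d \<in> atlas M" "p \<in> cdom c" "p \<in> cdom d"
  shows "linear (frechet_derivative (transition c d) (at (coords c p)))"
  using transition_has_derivative[OF assms] by (rule has_derivative_linear)

lemma transition_derivative_self:
  assumes M: "diff_atlas M" "c \<in> atlas M" and p: "p \<in> cdom c"
  shows "frechet_derivative (transition c c) (at (coords c p)) w = w"
proof -
  have "(transition c c has_derivative (\<lambda>w. w)) (at (coords c p))"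
    by (rule has_derivative_transform_within_open[OF has_derivative_ident open_chart_image[OF M]])
       (use p in \<open>auto simp: transition_coords[OF M]\<close>)
  from frechet_derivative_at[OF this] show ?thesis by (metis)
qed

lemma transition_derivative_cocycle:
  assumes M: "diff_atlas M" "c \<in> atlas M" "d \<in> atlas M" "e \<in> atlas M"
    and p: "p \<in> cdom c" "p \<in> cdom d" "p \<in> cdom e"
  shows "frechet_derivative (transition c e) (at (coords c p)) w =
    frechet_derivative (transition d e) (at (coords d p))
      (frechet_derivative (transition c d) (at (coords c p)) w)"
proof -
  \<comment> \<open>By injectivity of the chart this is the image of the triple overlap, and it is open.\<close>
  let ?S = "coords c ` (cdom c \<inter> cdom d) \<inter> coords c ` (cdom c \<inter> cdom e)"
  have S: "open ?S" "coords c p \<in> ?S"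
    using M p by (auto simp: diff_atlas_def)
  have eq: "transition d e (transition c d y) = transition c e y" if "y \<in> ?S" for y
  proof -
    from that obtain q q' where q: "y = coords c q" "q \<in> cdom c" "q \<in> cdom d"
      "y = coords c q'" "q' \<in> cdom c" "q' \<in> cdom e" by blast
    then have "q' = q" using M by (auto simp: diff_atlas_def inj_on_def)
    with q show ?thesis
      by (simp add: transition_coords[OF M(1,2)] transition_coords[OF M(1,3)])
  qed
  have "((\<lambda>y. transition d e (transition c d y)) has_derivative
      (\<lambda>w. frechet_derivative (transition d e) (at (coords d p))
        (frechet_derivative (transition c d) (at (coords c p)) w))) (at (coords c p))"
    using has_derivative_compose[OF transition_has_derivative[OF M(1,2,3) p(1,2)]]
      transition_has_derivative[OF M(1,3,4) p(2,3)]
    by (simp add: transition_coords[OF M(1,2) p(1)])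
  then have "(transition c e has_derivative
      (\<lambda>w. frechet_derivative (transition d e) (at (coords d p))
        (frechet_derivative (transition c d) (at (coords c p)) w))) (at (coords c p))"
    by (rule has_derivative_transform_within_open[OF _ S]) (use eq in blast)
  from frechet_derivative_at[OF this] show ?thesis by metis
qed

text \<open>The defining relation of a tangent vector between two arbitrary charts is the chain rule for the
  transition maps through the chart \<open>c\<close>.\<close>

lemma tangent_of_in_tangent_space:
  assumes "diff_atlas M" "c \<in> atlas M" "p \<in> cdom c"
  shows "tangent_of M c p w \<in> tangent_space M p"
  unfolding tangent_space_def tangent_of_def mem_Collect_eq
proof (intro conjI ballI impI allI)
  fix d e assume "d \<in> atlas M" "e \<in> atlas M" "p \<in> cdom d \<inter> cdom e"
  then show "(if e \<in> atlas M \<and> p \<in> cdom e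
        then frechet_derivative (transition c e) (at (coords c p)) w else 0) =
      frechet_derivative (transition d e) (at (coords d p))
        (if d \<in> atlas M \<and> p \<in> cdom d
         then frechet_derivative (transition c d) (at (coords c p)) w else 0)"
    using transition_derivative_cocycle[OF assms(1,2), of d e p w] assms(3) by simp
qed auto

lemma tangent_of_own_chart [simp]:
  "diff_atlas M \<Longrightarrow> c \<in> atlas M \<Longrightarrow> p \<in> cdom c \<Longrightarrow> tangent_of M c p w c = w"
  by (simp add: tangent_of_def transition_derivative_self)

lemma tangent_of_coordinates:
  assumes "c \<in> atlas M" "p \<in> cdom c" "v \<in> tangent_space M p"
  shows "tangent_of M c p (v c) = v"
proof
  fix d
  show "tangent_of M c p (v c) d = v d"
  proof (cases "d \<in> atlas M \<and> p \<in> cdom d")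
    case True
    then have "v d = frechet_derivative (transition c d) (at (coords c p)) (v c)"
      using assms unfolding tangent_space_def by blast
    with True show ?thesis by (simp only: tangent_of_def if_True simp_thms)
  next
    case False
    then have "v d = 0"
      using assms unfolding tangent_space_def by blast
    with False show ?thesis by (auto simp: tangent_of_def)
  qed
qed

lemma tangent_of_add_scale:
  assumes "diff_atlas M" "c \<in> atlas M" "p \<in> cdom c"
  shows "tangent_of M c p (a *\<^sub>R u + w) = (\<lambda>d. a *\<^sub>R tangent_of M c p u d + tangent_of M c p w d)"
  using transition_derivative_linear[OF assms(1,2) _ assms(3)]
  by (auto simp: tangent_of_def linear_add linear_scale)

lemma smooth_transition:
  assumes "smooth_manifold M" "c \<in> atlas M" "d \<in> atlas M"
  shows "smooth_on (transition c d) (coords c ` (cdom c \<inter> cdom d))"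
  using assms unfolding smooth_manifold_def by blast

lemma smooth_manifold_imp_diff_atlas:
  assumes "smooth_manifold M"
  shows "diff_atlas M"
proof -
  have "inj_on (coords c) (cdom c)" if "c \<in> atlas M" for c
  proof -
    have "homeomorphic_map (subtopology (mtop M) (cdom c)) (top_of_set (coords c ` cdom c)) (coords c)"
      and "openin (mtop M) (cdom c)"
      using assms that by (auto simp: smooth_manifold_def)
    then show ?thesis
      using homeomorphic_imp_injective_map
      by (metis openin_subset topspace_subtopology_subset)
  qed
  then show ?thesis
    unfolding diff_atlas_def
    using smooth_on_open[OF smooth_transition[OF assms]]
      smooth_on_differentiable[OF smooth_transition[OF assms]] by blast
qed

lemma chart_subset_topspace: "smooth_manifold M \<Longrightarrow> c \<in> atlas M \<Longrightarrow> cdom c \<subseteq> topspace (mtop M)"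
  by (auto simp: smooth_manifold_def)

lemma smooth_fun_chart:
  assumes "smooth_manifold M" "c \<in> atlas M" "smooth_fun M (topspace (mtop M)) f"
  shows "smooth_on (f \<circ> cinv c) (coords c ` cdom c)"
  using assms chart_subset_topspace[OF assms(1,2)]
  unfolding smooth_fun_def by (metis Int_absorb2)

text \<open>In another chart \<open>d\<close> the coordinates of the field form a column of the Jacobian of the transition
  map from \<open>c\<close> to \<open>d\<close>, composed with the transition map from \<open>d\<close> to \<open>c\<close>.  Hence connections may
  be applied to the coordinate fields of a chart.\<close>

lemma coord_field_vector_field:
  fixes M :: "('p, real^'n) manifold"
  assumes M: "smooth_manifold M" and c: "c \<in> atlas M"
  shows "vector_field M (cdom c) (coord_field M c i)"
  unfolding vector_field_def
proof (intro conjI ballI)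
  note A = smooth_manifold_imp_diff_atlas[OF M]
  show "coord_field M c i p \<in> tangent_space M p" if "p \<in> cdom c" for p
    unfolding coord_field_def by (rule tangent_of_in_tangent_space[OF A c that])
  fix d assume d: "d \<in> atlas M"
  have sm: "smooth_on (transition c d) (coords c ` (cdom c \<inter> cdom d))"
    "smooth_on (transition d c) (coords d ` (cdom d \<inter> cdom c))"
    using smooth_transition[OF M c d] smooth_transition[OF M d c] by auto
  have "smooth_on (\<lambda>y. frechet_derivative (transition c d) (at (transition d c y)) (axis i 1))
    (coords d ` (cdom d \<inter> cdom c))"
    by (rule smooth_on_compose[OF smooth_on_partial[OF sm(1)] sm(2)])
       (auto simp: transition_coords[OF A d])
  then show "smooth_on (\<lambda>y. coord_field M c i (cinv d y) d) (coords d ` (cdom d \<inter> cdom c))"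
    by (rule smooth_on_cong)
       (auto simp: coord_field_def tangent_of_def cinv_coords[OF A d] transition_coords[OF A d] d)
qed


section \<open>The tangent bundle\<close>

lemma tangent_chart_simps [simp]:
  "(p, v) \<in> cdom (tangent_chart M c) \<longleftrightarrow> p \<in> cdom c \<and> v \<in> tangent_space M p"
  "coords (tangent_chart M c) (p, v) = (coords c p, v c)"
  by (auto simp: tangent_chart_def)

lemma atlas_tangent_bundle [simp]: "atlas (tangent_bundle M) = tangent_chart M ` atlas M"
  by (simp add: tangent_bundle_def)

lemma inj_on_tangent_chart:
  assumes M: "diff_atlas M" and c: "c \<in> atlas M"
  shows "inj_on (coords (tangent_chart M c)) (cdom (tangent_chart M c))"
proof (rule inj_onI, clarsimp)
  fix p v q w
  assume *: "p \<in> cdom c" "v \<in> tangent_space M p" "q \<in> cdom c" "w \<in> tangent_space M q"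
    "coords c p = coords c q" "v c = w c"
  then have "p = q" using M c by (auto simp: diff_atlas_def inj_on_def)
  with * tangent_of_coordinates[OF c] show "p = q \<and> v = w" by metis
qed

lemma tangent_chart_image:
  assumes M: "diff_atlas M" and c: "c \<in> atlas M"
  shows "coords (tangent_chart M c) ` {(p, v). p \<in> S \<and> p \<in> cdom c \<and> v \<in> tangent_space M p} =
    coords c ` (cdom c \<inter> S) \<times> UNIV"
proof (intro equalityI subsetI)
  fix z assume "z \<in> coords c ` (cdom c \<inter> S) \<times> (UNIV :: 'b set)"
  then obtain p w where p: "z = (coords c p, w)" "p \<in> cdom c" "p \<in> S" by auto
  then have "z = coords (tangent_chart M c) (p, tangent_of M c p w)"
    using M c by simp
  then show "z \<in> coords (tangent_chart M c) ` {(p, v). p \<in> S \<and> p \<in> cdom c \<and> v \<in> tangent_space M p}"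
    using p tangent_of_in_tangent_space[OF M c] by blast
qed auto

lemma tangent_chart_image_Int:
  assumes M: "diff_atlas M" and c: "c \<in> atlas M"
  shows "coords (tangent_chart M c) ` (cdom (tangent_chart M c) \<inter> cdom (tangent_chart M d)) =
    coords c ` (cdom c \<inter> cdom d) \<times> UNIV"
proof -
  have "cdom (tangent_chart M c) \<inter> cdom (tangent_chart M d) =
    {(p, v). p \<in> cdom d \<and> p \<in> cdom c \<and> v \<in> tangent_space M p}"
    by (auto simp: tangent_chart_def)
  then show ?thesis by (simp only: tangent_chart_image[OF assms])
qed

lemma cinv_tangent_chart:
  assumes M: "diff_atlas M" and c: "c \<in> atlas M" and x: "x \<in> coords c ` cdom c"
  shows "cinv (tangent_chart M c) (x, w) = (cinv c x, tangent_of M c (cinv c x) w)"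
proof -
  from x obtain p where p: "p \<in> cdom c" "x = coords c p" by auto
  have "cinv (tangent_chart M c) (coords (tangent_chart M c) (p, tangent_of M c p w)) =
    (p, tangent_of M c p w)"
    unfolding cinv_def
    by (rule inv_into_f_f[OF inj_on_tangent_chart[OF M c]])
       (simp add: p tangent_of_in_tangent_space[OF M c])
  then show ?thesis
    using p M c by (simp add: cinv_coords)
qed

text \<open>This is the fibre component of a transition map of the tangent bundle.  Expanding the vector
  \<open>snd z\<close> in the standard basis turns it into a sum of coefficients, linear in \<open>z\<close>, times partial
  derivatives that depend on \<open>fst z\<close> only.\<close>

lemma transition_derivative_differentiable:
  assumes M: "smooth_manifold M" and c: "c \<in> atlas M" "d \<in> atlas M"
    and x: "x \<in> coords c ` (cdom c \<inter> cdom d)"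
  shows "(\<lambda>z. frechet_derivative (transition c d) (at (fst z)) (snd z)) differentiable (at (x, w))"
proof -
  let ?S = "coords c ` (cdom c \<inter> cdom d)"
  have sm: "smooth_on (transition c d) ?S"
    by (rule smooth_transition[OF M c])
  have partial: "(\<lambda>z. frechet_derivative (transition c d) (at (fst z)) b) differentiable (at (x, w))"
    if "b \<in> Basis" for b
  proof -
    have "((\<lambda>y. frechet_derivative (transition c d) (at y) b) \<circ> fst) differentiable (at (x, w))"
      by (rule differentiable_chain_at)
         (use smooth_on_differentiable[OF smooth_on_partial[OF sm that]] x in
           \<open>auto intro: bounded_linear_imp_differentiable bounded_linear_fst\<close>)
    then show ?thesis by (simp add: o_def)
  qed
  have coeff: "(\<lambda>z. snd z \<bullet> b) differentiable (at (x, w))" for b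
    by (rule bounded_linear_imp_differentiable)
       (rule bounded_linear_compose[OF bounded_linear_inner_left bounded_linear_snd])
  have "(\<lambda>z. \<Sum>b\<in>Basis. (snd z \<bullet> b) *\<^sub>R frechet_derivative (transition c d) (at (fst z)) b)
      differentiable (at (x, w))"
    by (intro differentiable_sum differentiable_scaleR ballI partial coeff) auto
  then obtain L where L: "((\<lambda>z. \<Sum>b\<in>Basis. (snd z \<bullet> b) *\<^sub>R
      frechet_derivative (transition c d) (at (fst z)) b) has_derivative L) (at (x, w))"
    by (auto simp: differentiable_def)
  have eq: "(\<Sum>b\<in>Basis. (snd z \<bullet> b) *\<^sub>R frechet_derivative (transition c d) (at (fst z)) b) =
      frechet_derivative (transition c d) (at (fst z)) (snd z)" if "z \<in> ?S \<times> UNIV" for z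
  proof -
    have "linear (frechet_derivative (transition c d) (at (fst z)))"
      using smooth_on_differentiable[OF sm, of "fst z"] that
      by (intro linear_frechet_derivative) auto
    then have "(\<Sum>b\<in>Basis. (snd z \<bullet> b) *\<^sub>R frechet_derivative (transition c d) (at (fst z)) b) =
        frechet_derivative (transition c d) (at (fst z)) (\<Sum>b\<in>Basis. (snd z \<bullet> b) *\<^sub>R b)"
      by (simp add: linear_sum linear_scale)
    then show ?thesis by (simp add: euclidean_representation)
  qed
  have "((\<lambda>z. frechet_derivative (transition c d) (at (fst z)) (snd z)) has_derivative L) (at (x, w))"
    by (rule has_derivative_transform_within_open[OF L, of "?S \<times> UNIV"])
       (use eq x smooth_on_open[OF sm] in \<open>auto intro: open_Times\<close>)
  then show ?thesis by (auto simp: differentiable_def)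
qed

lemma diff_atlas_tangent_bundle:
  assumes "smooth_manifold M"
  shows "diff_atlas (tangent_bundle M)"
proof -
  note M = smooth_manifold_imp_diff_atlas[OF assms]
  have "open (coords (tangent_chart M c) ` (cdom (tangent_chart M c) \<inter> cdom (tangent_chart M d)))"
    if "c \<in> atlas M" "d \<in> atlas M" for c d
    using M that by (simp add: tangent_chart_image_Int diff_atlas_def open_Times)
  moreover have "transition (tangent_chart M c) (tangent_chart M d) differentiable (at z)"
    if c: "c \<in> atlas M" and d: "d \<in> atlas M" and
      z: "z \<in> coords (tangent_chart M c) ` (cdom (tangent_chart M c) \<inter> cdom (tangent_chart M d))"
    for c d z
  proof -
    let ?S = "coords c ` (cdom c \<inter> cdom d)"
    have S: "open (?S \<times> (UNIV :: 'b set))" "z \<in> ?S \<times> UNIV"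
      using M c d z by (auto simp: tangent_chart_image_Int diff_atlas_def open_Times)
    then have "transition c d differentiable (at (fst z))"
      using M c d by (auto simp: diff_atlas_def)
    then have "(transition c d \<circ> fst) differentiable (at z)"
      by (intro differentiable_chain_at[OF bounded_linear_imp_differentiable[OF bounded_linear_fst]])
    then obtain L1 where L1: "((\<lambda>z. transition c d (fst z)) has_derivative L1) (at z)"
      by (auto simp: differentiable_def o_def)
    obtain L2 where L2: "((\<lambda>z. frechet_derivative (transition c d) (at (fst z)) (snd z))
        has_derivative L2) (at z)"
      using transition_derivative_differentiable[OF assms c d, of "fst z" "snd z"] S
      by (auto simp: differentiable_def)
    have "(transition (tangent_chart M c) (tangent_chart M d) has_derivative
        (\<lambda>h. (L1 h, L2 h))) (at z)"
    proof (rule has_derivative_transform_within_open[OF has_derivative_Pair[OF L1 L2] S])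
      fix z' assume "z' \<in> ?S \<times> (UNIV :: 'b set)"
      then obtain p w where "z' = (coords c p, w)" "p \<in> cdom c" "p \<in> cdom d" by auto
      then show "(transition c d (fst z'), frechet_derivative (transition c d) (at (fst z')) (snd z')) =
          transition (tangent_chart M c) (tangent_chart M d) z'"
        using M c d
        by (simp add: transition_def[of "tangent_chart M c"] cinv_tangent_chart cinv_coords
            transition_coords tangent_of_def)
    qed
    then show ?thesis by (auto simp: differentiable_def)
  qed
  ultimately show ?thesis
    using inj_on_tangent_chart[OF M] by (simp add: diff_atlas_def)
qed

text \<open>The topology is defined through a predicate on sets; it has to be checked that this predicate is
  closed under intersections, where the injectivity of the charts enters, and under unions.\<close>

lemma topspace_tangent_bundle:
  assumes "smooth_manifold M"
  shows "topspace (mtop (tangent_bundle M)) =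
    {(p, v). p \<in> topspace (mtop M) \<and> v \<in> tangent_space M p}" (is "_ = ?E")
proof -
  note M = smooth_manifold_imp_diff_atlas[OF assms]
  let ?T = "tangent_chart M"
  define opn where "opn = (\<lambda>W. W \<subseteq> ?E \<and>
    (\<forall>c\<in>atlas M. open (coords (?T c) ` (cdom (?T c) \<inter> W))))"
  have "istopology opn"
    unfolding istopology_def
  proof (intro conjI allI impI)
    fix V W assume VW: "opn V" "opn W"
    have "coords (?T c) ` (cdom (?T c) \<inter> (V \<inter> W)) =
        coords (?T c) ` (cdom (?T c) \<inter> V) \<inter> coords (?T c) ` (cdom (?T c) \<inter> W)"
      if "c \<in> atlas M" for c
      using inj_on_tangent_chart[OF M that]
      by (subst inj_on_image_Int[symmetric]) (auto intro: arg_cong[where f = "image _"])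
    with VW show "opn (V \<inter> W)" by (auto simp: opn_def open_Int)
  next
    fix K assume K: "\<forall>W\<in>K. opn W"
    have "coords (?T c) ` (cdom (?T c) \<inter> \<Union>K) = (\<Union>W\<in>K. coords (?T c) ` (cdom (?T c) \<inter> W))" for c
      by blast
    with K show "opn (\<Union>K)" by (force simp: opn_def intro: open_UN)
  qed
  then have "openin (mtop (tangent_bundle M)) = opn"
    by (simp add: tangent_bundle_def opn_def[symmetric] topology_inverse')
  moreover have "opn ?E"
  proof -
    have "coords (?T c) ` (cdom (?T c) \<inter> ?E) = coords c ` cdom c \<times> UNIV" if "c \<in> atlas M" for c
    proof -
      have "cdom (?T c) \<inter> ?E =
          {(p, v). p \<in> topspace (mtop M) \<and> p \<in> cdom c \<and> v \<in> tangent_space M p}"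
        by (auto simp: tangent_chart_def)
      then show ?thesis
        using tangent_chart_image[OF M that, of "topspace (mtop M)"]
          chart_subset_topspace[OF assms that] by (simp add: Int_absorb2)
    qed
    then show ?thesis
      using open_chart_image[OF M] by (auto simp: opn_def open_Times)
  qed
  moreover have "W \<subseteq> ?E" if "opn W" for W
    using that unfolding opn_def by (rule conjunct1)
  ultimately show ?thesis
    by (simp only: topspace_def) (rule cSup_eq_maximum; simp)
qed

lemma tangent_chart_subset_topspace:
  assumes "smooth_manifold M" "c \<in> atlas M"
  shows "cdom (tangent_chart M c) \<subseteq> topspace (mtop (tangent_bundle M))"
  using chart_subset_topspace[OF assms] topspace_tangent_bundle[OF assms(1)] by auto

lemma tangent_chart_image_whole:
  assumes "diff_atlas M" "c \<in> atlas M"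
  shows "coords (tangent_chart M c) ` cdom (tangent_chart M c) = coords c ` cdom c \<times> UNIV"
  using tangent_chart_image_Int[OF assms, of c] by simp

section \<open>Metric-compatible connections\<close>

lemma metric_linear:
  assumes "diff_atlas M" "riemannian_metric M g" "c \<in> atlas M" "p \<in> cdom c" "p \<in> topspace (mtop M)"
  shows "linear (\<lambda>u. g p (tangent_of M c p u) (tangent_of M c p w))"
proof -
  have *: "g p (tangent_of M c p (a *\<^sub>R u + v)) (tangent_of M c p w) =
      a * g p (tangent_of M c p u) (tangent_of M c p w) +
      g p (tangent_of M c p v) (tangent_of M c p w)" for a u v
    using assms(2,5) tangent_of_in_tangent_space[OF assms(1,3,4)]
    by (simp add: riemannian_metric_def tangent_of_add_scale[OF assms(1,3,4)])
  from *[of 1 0 0] have "g p (tangent_of M c p 0) (tangent_of M c p w) = 0" by simp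
  with * show ?thesis
    by (intro linearI) (metis scaleR_one mult_1, metis add.right_neutral real_scaleR_def)
qed

lemma metric_symmetric:
  assumes "diff_atlas M" "riemannian_metric M g" "c \<in> atlas M" "p \<in> cdom c" "p \<in> topspace (mtop M)"
  shows "g p (tangent_of M c p u) (tangent_of M c p w) = g p (tangent_of M c p w) (tangent_of M c p u)"
  using assms(2,5) tangent_of_in_tangent_space[OF assms(1,3,4)]
  by (simp add: riemannian_metric_def)

lemma vec_axis_expansion: "(w :: real^'n) = (\<Sum>k\<in>UNIV. w $ k *\<^sub>R axis k 1)"
  using basis_expansion[of w] by (simp add: scalar_mult_eq_scaleR)

lemma linear_axis_expansion:
  fixes L :: "real^'n \<Rightarrow> real"
  assumes "linear L"
  shows "L w = (\<Sum>k\<in>UNIV. w $ k * L (axis k 1))"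
  by (subst vec_axis_expansion[of w]) (simp add: linear_sum[OF assms] linear_scale[OF assms])

text \<open>Makes the Christoffel symbols available as the coordinates of a tangent vector, so that
  the metric can be expanded bilinearly in them.\<close>

lemma connection_coord_fields:
  fixes M :: "('p, real^'n) manifold"
  assumes M: "smooth_manifold M" and D: "affine_connection M D" and c: "c \<in> atlas M" "p \<in> cdom c"
  shows "D (cdom c) (coord_field M c i) (coord_field M c j) p =
    tangent_of M c p (\<chi> k. christoffel M D c k i j p)"
proof -
  have op: "openin (mtop M) (cdom c)"
    using M c by (auto simp: smooth_manifold_def)
  have "\<forall>U X Y. openin (mtop M) U \<and> vector_field M U X \<and> vector_field M U Y \<longrightarrow>
        vector_field M U (D U X Y)"
    using D unfolding affine_connection_def by (rule conjunct1)
  then have "vector_field M (cdom c) (D (cdom c) (coord_field M c i) (coord_field M c j))"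
    using op coord_field_vector_field[OF M c(1)] by blast
  then have "D (cdom c) (coord_field M c i) (coord_field M c j) p \<in> tangent_space M p"
    using c by (simp add: vector_field_def)
  from tangent_of_coordinates[OF c this] show ?thesis
    by (simp add: christoffel_def)
qed

text \<open>Compatibility, evaluated on the coordinate fields, reads
  \<open>\<partial>\<^sub>k g\<^sub>i\<^sub>j = \<Gamma>\<^sup>l\<^sub>k\<^sub>i g\<^sub>l\<^sub>j + \<Gamma>\<^sup>l\<^sub>k\<^sub>j g\<^sub>i\<^sub>l\<close>; in matrix notation, with \<open>(\<Gamma>\<^sub>h)\<^sub>i\<^sub>l = h\<^sup>k \<Gamma>\<^sup>l\<^sub>k\<^sub>i\<close>, the derivative of
  the Gram matrix \<open>G\<close> in direction \<open>h\<close> is \<open>\<Gamma>\<^sub>h G + G \<Gamma>\<^sub>h\<^sup>T\<close>.\<close>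

lemma metric_matrix_has_derivative:
  fixes M :: "('p, real^'n) manifold" and g D c p
  defines "\<Gamma> \<equiv> \<lambda>h. (\<chi> i l. \<Sum>k\<in>UNIV. h $ k * christoffel M D c l k i p)"
    and "G \<equiv> metric_matrix M g c"
  assumes M: "smooth_manifold M" and g: "riemannian_metric M g" and D: "affine_connection M D"
    and comp: "metric_compatible M g D" and c: "c \<in> atlas M" "p \<in> cdom c"
  shows "((\<lambda>y. G (cinv c y) $ i $ j) has_derivative
     (\<lambda>h. (\<Gamma> h ** G p + G p ** transpose (\<Gamma> h)) $ i $ j)) (at (coords c p))"
proof -
  note A = smooth_manifold_imp_diff_atlas[OF M]
  have p: "p \<in> topspace (mtop M)" using chart_subset_topspace[OF M c(1)] c(2) by blast
  have op: "openin (mtop M) (cdom c)"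
    using M c by (auto simp: smooth_manifold_def)
  let ?B = "\<lambda>u w. g p (tangent_of M c p u) (tangent_of M c p w)"
  have G: "G p $ l $ m = ?B (axis l 1) (axis m 1)" for l m
    by (simp add: G_def metric_matrix_def coord_field_def)
  have left: "?B (\<chi> l. \<gamma> l) (axis m 1) = (\<Sum>l\<in>UNIV. \<gamma> l * G p $ l $ m)" for \<gamma> m
    by (subst linear_axis_expansion[OF metric_linear[OF A g c p]]) (simp add: G)
  have right: "?B (axis m 1) (\<chi> l. \<gamma> l) = (\<Sum>l\<in>UNIV. \<gamma> l * G p $ m $ l)" for \<gamma> m
    using left[of \<gamma> m] by (simp add: G metric_symmetric[OF A g c p, of "axis m 1"])
  define f where "f = (\<lambda>y. G (cinv c y) $ i $ j)"
  define L where "L = frechet_derivative f (at (coords c p))"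
  have "smooth_on f (coords c ` cdom c)"
    using g c unfolding riemannian_metric_def f_def G_def metric_matrix_def coord_field_def by simp
  then have fL: "(f has_derivative L) (at (coords c p))"
    using c smooth_on_differentiable unfolding L_def frechet_derivative_works[symmetric] by blast
  have "L (axis k 1) = (\<Sum>l\<in>UNIV. christoffel M D c l k i p * G p $ l $ j) +
      (\<Sum>l\<in>UNIV. christoffel M D c l k j p * G p $ i $ l)" for k
  proof -
    have "nabla_metric g D (cdom c) c (coord_field M c k) (coord_field M c i) (coord_field M c j) p = 0"
      using comp op coord_field_vector_field[OF M c(1)] c unfolding metric_compatible_def by blast
    moreover have "(\<lambda>q. g q (coord_field M c i q) (coord_field M c j q)) \<circ> cinv c = f"
      by (simp add: f_def G_def metric_matrix_def o_def)
    ultimately have "L (coord_field M c k p c) =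
        g p (D (cdom c) (coord_field M c k) (coord_field M c i) p) (coord_field M c j p) +
        g p (coord_field M c i p) (D (cdom c) (coord_field M c k) (coord_field M c j) p)"
      by (simp add: nabla_metric_def diff_in_def L_def)
    then show ?thesis
      unfolding connection_coord_fields[OF M D c] by (simp add: coord_field_def A c left right)
  qed
  note Laxis = this
  have "L h = (\<Gamma> h ** G p + G p ** transpose (\<Gamma> h)) $ i $ j" for h
  proof -
    have "L h = (\<Sum>k\<in>UNIV. h $ k * L (axis k 1))"
      by (rule linear_axis_expansion[OF has_derivative_linear[OF fL]])
    also have "\<dots> = (\<Sum>k\<in>UNIV. \<Sum>l\<in>UNIV. h $ k * christoffel M D c l k i p * G p $ l $ j) +
        (\<Sum>k\<in>UNIV. \<Sum>l\<in>UNIV. G p $ i $ l * (h $ k * christoffel M D c l k j p))"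
      by (simp add: Laxis algebra_simps sum_distrib_left sum.distrib)
    also have "\<dots> = (\<Sum>l\<in>UNIV. \<Sum>k\<in>UNIV. h $ k * christoffel M D c l k i p * G p $ l $ j) +
        (\<Sum>l\<in>UNIV. \<Sum>k\<in>UNIV. G p $ i $ l * (h $ k * christoffel M D c l k j p))"
      by (intro arg_cong2[where f = "(+)"] sum.swap)
    also have "\<dots> = (\<Gamma> h ** G p + G p ** transpose (\<Gamma> h)) $ i $ j"
      by (simp add: \<Gamma>_def matrix_matrix_mult_def transpose_def sum_distrib_left sum_distrib_right)
    finally show ?thesis .
  qed
  then have "L = (\<lambda>h. (\<Gamma> h ** G p + G p ** transpose (\<Gamma> h)) $ i $ j)" by blast
  with fL show ?thesis unfolding f_def by simp
qed

text \<open>The two terms that compatibility gives for the derivative of the Gram matrix have the same trace,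
  hence the factor 2.  The trace is over the upper and the second lower index of the Christoffel
  symbols; the first lower index is the direction of differentiation.\<close>

lemma det_metric_has_derivative:
  fixes M :: "('p, real^'n) manifold"
  assumes M: "smooth_manifold M" "riemannian_metric M g" "affine_connection M D"
    "metric_compatible M g D" "c \<in> atlas M" "p \<in> cdom c"
  shows "((\<lambda>y. det (metric_matrix M g c (cinv c y))) has_derivative
     (\<lambda>h. 2 * (\<Sum>k\<in>UNIV. (\<Sum>i\<in>UNIV. christoffel M D c i k i p) * h $ k) *
        det (metric_matrix M g c p))) (at (coords c p))"
proof -
  have cp: "cinv c (coords c p) = p"
    by (rule cinv_coords[OF smooth_manifold_imp_diff_atlas[OF M(1)] M(5,6)])
  have "((\<lambda>y. det (metric_matrix M g c (cinv c y))) has_derivative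
     (\<lambda>h. 2 * trace (\<chi> i l. \<Sum>k\<in>UNIV. h $ k * christoffel M D c l k i p) *
        det (metric_matrix M g c (cinv c (coords c p))))) (at (coords c p))"
    by (rule det_has_derivative_congruence)
       (use metric_matrix_has_derivative[OF assms] in \<open>simp only: cp\<close>)
  moreover have "trace (\<chi> i l. \<Sum>k\<in>UNIV. h $ k * christoffel M D c l k i p) =
      (\<Sum>k\<in>UNIV. (\<Sum>i\<in>UNIV. christoffel M D c i k i p) * h $ k)" for h
    unfolding trace_def by (simp, subst sum.swap) (simp add: sum_distrib_left mult.commute)
  ultimately show ?thesis by (simp only: cp)
qed

section \<open>The divergence of the geodesic spray\<close>

lemma sum_UNIV_sum_type:
  "(\<Sum>a\<in>(UNIV :: ('a::finite + 'b::finite) set). f a) = (\<Sum>i\<in>UNIV. f (Inl i)) + (\<Sum>i\<in>UNIV. f (Inr i))"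
proof -
  have "sum f (UNIV <+> UNIV) = sum (f \<circ> Inl) UNIV + sum (f \<circ> Inr) UNIV"
    by (rule sum.Plus) auto
  then show ?thesis by (simp add: o_def)
qed

text \<open>The form \<open>dx\<^sup>1 \<and> \<dots> \<and> dx\<^sup>n \<and> dv\<^sup>1 \<and> \<dots> \<and> dv\<^sup>n\<close> in coordinates.\<close>

definition coord_det :: "('n::finite + 'n \<Rightarrow> (real^'n) \<times> (real^'n)) \<Rightarrow> real" where
  "coord_det b = det (\<chi> a s. coord_covector a (b s))"

text \<open>The basis \<open>\<partial>/\<partial>x\<^sup>i\<close>, \<open>\<partial>/\<partial>v\<^sup>i\<close> dual to \<open>coord_covector\<close>.\<close>

definition coord_vector :: "'n::finite + 'n \<Rightarrow> (real^'n) \<times> (real^'n)" where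
  "coord_vector a = (case a of Inl i \<Rightarrow> (axis i 1, 0) | Inr i \<Rightarrow> (0, axis i 1))"

lemma linear_coord_covector: "linear (coord_covector a)"
  by (cases a) (auto intro!: linearI)

lemma coord_covector_vector: "coord_covector a (coord_vector s) = (if a = s then 1 else 0)"
  by (cases a; cases s) (auto simp: coord_vector_def axis_def)

lemma coord_det_coord_vector: "coord_det (coord_vector :: 'n::finite + 'n \<Rightarrow> _) = 1"
proof -
  have "(\<chi> a s. coord_covector a (coord_vector s)) = (mat 1 :: real^('n + 'n)^('n + 'n))"
    by (simp add: mat_def coord_covector_vector)
  then show ?thesis by (simp add: coord_det_def)
qed

lemma coord_vector_expansion: "z = (\<Sum>a\<in>UNIV. coord_covector a z *\<^sub>R coord_vector a)"
proof -
  have "coord_covector s z = coord_covector s (\<Sum>a\<in>UNIV. coord_covector a z *\<^sub>R coord_vector a)" for s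
    by (simp add: linear_sum[OF linear_coord_covector] linear_scale[OF linear_coord_covector]
        coord_covector_vector if_distrib cong: if_cong)
  from this[of "Inl _"] this[of "Inr _"] show ?thesis
    by (intro prod_eqI) (simp_all add: vec_eq_iff)
qed

text \<open>This turns the sum in the Lie derivative into a divergence.  The vectors are the columns of a
  matrix \<open>N\<close> and \<open>A\<close> acts on it from the left, so columns are replaced by those of a left multiple;
  passing to rows makes the sum a trace, whether or not the vectors are independent.\<close>

lemma sum_coord_det_replace:
  assumes "linear A"
  shows "(\<Sum>i\<in>UNIV. coord_det (b(i := A (b i)))) =
    (\<Sum>a\<in>UNIV. coord_covector a (A (coord_vector a))) * coord_det b"
proof -
  define N where "N = (\<chi> a s. coord_covector a (b s))"
  define P where "P = (\<chi> a s. coord_covector a (A (coord_vector s)))"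
  have AN: "coord_covector a (A (b s)) = (P ** N) $ a $ s" for a s
  proof -
    have "A (b s) = (\<Sum>e\<in>UNIV. coord_covector e (b s) *\<^sub>R A (coord_vector e))"
      using coord_vector_expansion[of "b s"]
      by (metis (no_types, lifting) assms linear_scale linear_sum sum.cong)
    then show ?thesis
      by (simp add: linear_sum[OF linear_coord_covector] linear_scale[OF linear_coord_covector]
          matrix_matrix_mult_def P_def N_def mult.commute)
  qed
  have "coord_det (b(i := A (b i))) =
      det (\<chi> r s. if s = i then (P ** N) $ r $ s else N $ r $ s)" for i
    unfolding coord_det_def AN[symmetric]
    by (rule arg_cong[where f = det]) (simp add: vec_eq_iff N_def)
  then have "(\<Sum>i\<in>UNIV. coord_det (b(i := A (b i)))) = trace P * det N"
    by (simp only: sum_det_replace_column sum_det_replace_row_matmul)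
  then show ?thesis
    by (simp add: trace_def P_def N_def coord_det_def)
qed

lemma spray_coordinates:
  assumes M: "diff_atlas M" and X: "geodesic_spray M D X" and c: "c \<in> atlas M" "p \<in> cdom c"
  shows "X (cinv (tangent_chart M c) (coords c p, w)) (tangent_chart M c) =
    (w, \<chi> i. - (\<Sum>j\<in>UNIV. \<Sum>k\<in>UNIV. christoffel M D c i j k p * w $ j * w $ k))"
proof -
  have "(p, tangent_of M c p w) \<in> cdom (tangent_chart M c)"
    using M c by (simp add: tangent_of_in_tangent_space)
  then have "X (p, tangent_of M c p w) (tangent_chart M c) = (tangent_of M c p w c,
      \<chi> i. - (\<Sum>j\<in>UNIV. \<Sum>k\<in>UNIV. christoffel M D c i j k p * tangent_of M c p w c $ j
        * tangent_of M c p w c $ k))"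
    using X c unfolding geodesic_spray_def by blast
  then show ?thesis
    using M c by (simp add: cinv_tangent_chart cinv_coords)
qed

lemma spray_coordinates_differentiable:
  assumes M: "smooth_manifold M" and X: "geodesic_spray M D X" and c: "c \<in> atlas M" "p \<in> cdom c"
  shows "(\<lambda>z. X (cinv (tangent_chart M c) z) (tangent_chart M c)) differentiable (at (coords c p, w))"
proof (rule smooth_on_differentiable)
  have dom: "cdom (tangent_chart M c) \<inter> topspace (mtop (tangent_bundle M)) = cdom (tangent_chart M c)"
    using tangent_chart_subset_topspace[OF M c(1)] by blast
  have "vector_field (tangent_bundle M) (topspace (mtop (tangent_bundle M))) X"
    using X unfolding geodesic_spray_def by (rule conjunct1)
  then have "smooth_on (\<lambda>z. X (cinv (tangent_chart M c) z) (tangent_chart M c))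
      (coords (tangent_chart M c) ` (cdom (tangent_chart M c) \<inter> topspace (mtop (tangent_bundle M))))"
    using c(1) unfolding vector_field_def atlas_tangent_bundle by blast
  then show "smooth_on (\<lambda>z. X (cinv (tangent_chart M c) z) (tangent_chart M c))
      (coords c ` cdom c \<times> UNIV)"
    by (simp only: dom tangent_chart_image_whole[OF smooth_manifold_imp_diff_atlas[OF M] c(1)])
qed (use c in auto)

text \<open>The horizontal part of the spray is \<open>v\<close>, which has no derivative in the directions of \<open>x\<close>.  The
  vertical part enters only through its derivatives along the fibre, where it is a quadratic
  polynomial, so the derivatives of the Christoffel symbols do not appear.\<close>

lemma spray_divergence:
  fixes M :: "('p, real^'n) manifold"
  assumes M: "smooth_manifold M" and X: "geodesic_spray M D X" and c: "c \<in> atlas M" "p \<in> cdom c"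
    and A: "((\<lambda>z. X (cinv (tangent_chart M c) z) (tangent_chart M c)) has_derivative A)
      (at (coords c p, w))"
  shows "(\<Sum>a\<in>UNIV. coord_covector a (A (coord_vector a))) =
    - (\<Sum>k\<in>UNIV. ((\<Sum>i\<in>UNIV. christoffel M D c i i k p) +
        (\<Sum>i\<in>UNIV. christoffel M D c i k i p)) * w $ k)"
proof -
  note MA = smooth_manifold_imp_diff_atlas[OF M]
  let ?Xc = "\<lambda>z. X (cinv (tangent_chart M c) z) (tangent_chart M c)"
  let ?G = "\<lambda>i j k. christoffel M D c i j k p"
  have "((\<lambda>z. fst (?Xc z)) has_derivative (\<lambda>h. fst (A h))) (at (coords c p, w))"
    by (rule bounded_linear.has_derivative[OF bounded_linear_fst A])
  \<comment> \<open>The first component of the spray coincides with \<open>snd\<close> near the point.\<close>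
  then have "(snd has_derivative (\<lambda>h. fst (A h))) (at (coords c p, w))"
    by (rule has_derivative_transform_within_open[of _ _ _ _ "coords c ` cdom c \<times> UNIV"])
       (use c open_chart_image[OF MA c(1)] in
         \<open>auto simp: open_Times spray_coordinates[OF MA X c(1)]\<close>)
  then have "(\<lambda>h. fst (A h)) = snd"
    using has_derivative_unique bounded_linear_imp_has_derivative[OF bounded_linear_snd] by blast
  then have horizontal: "fst (A h) = snd h" for h by (rule fun_cong)
  have vertical: "snd (A (0, e)) $ i =
      - (\<Sum>j\<in>UNIV. \<Sum>k\<in>UNIV. ?G i j k * (e $ j * w $ k + w $ j * e $ k))" for e i
  proof -
    \<comment> \<open>Restricting to the fibre through the point leaves a quadratic polynomial.\<close>
    have slice: "((\<lambda>u. (coords c p, u)) has_derivative (\<lambda>e. (0, e))) (at w)"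
      by (intro has_derivative_Pair has_derivative_const has_derivative_ident)
    have 1: "((\<lambda>u. snd (?Xc (coords c p, u)) $ i) has_derivative (\<lambda>e. snd (A (0, e)) $ i)) (at w)"
      by (rule bounded_linear.has_derivative[OF bounded_linear_vec_nth
            bounded_linear.has_derivative[OF bounded_linear_snd has_derivative_compose[OF slice A]]])
    have 2: "((\<lambda>u. - (\<Sum>j\<in>UNIV. \<Sum>k\<in>UNIV. ?G i j k * (u $ j * u $ k))) has_derivative
        (\<lambda>e. - (\<Sum>j\<in>UNIV. \<Sum>k\<in>UNIV. ?G i j k * (w $ j * e $ k + e $ j * w $ k)))) (at w)"
      by (intro has_derivative_minus has_derivative_sum has_derivative_mult_right has_derivative_mult
          bounded_linear_imp_has_derivative bounded_linear_vec_nth)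
    have "(\<lambda>e. snd (A (0, e)) $ i) =
        (\<lambda>e. - (\<Sum>j\<in>UNIV. \<Sum>k\<in>UNIV. ?G i j k * (w $ j * e $ k + e $ j * w $ k)))"
      by (rule has_derivative_unique[OF 1])
         (use 2 in \<open>simp add: spray_coordinates[OF MA X c] mult.assoc\<close>)
    from fun_cong[OF this, of e] show ?thesis by (simp add: add.commute)
  qed
  have "(\<Sum>a\<in>UNIV. coord_covector a (A (coord_vector a))) = (\<Sum>i\<in>UNIV. snd (A (0, axis i 1)) $ i)"
    by (simp add: sum_UNIV_sum_type coord_vector_def horizontal)
  also have "\<dots> = - (\<Sum>i\<in>UNIV. (\<Sum>k\<in>UNIV. ?G i i k * w $ k) + (\<Sum>k\<in>UNIV. ?G i k i * w $ k))"
  proof -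
    have "(\<Sum>j\<in>UNIV. \<Sum>k\<in>UNIV. ?G i j k * (axis i 1 $ j * w $ k + w $ j * axis i 1 $ k)) =
        (\<Sum>k\<in>UNIV. ?G i i k * w $ k) + (\<Sum>k\<in>UNIV. ?G i k i * w $ k)" for i
    proof -
      have "(\<Sum>j\<in>UNIV. \<Sum>k\<in>UNIV. ?G i j k * (axis i 1 $ j * w $ k)) =
          (\<Sum>j\<in>UNIV. if j = i then (\<Sum>k\<in>UNIV. ?G i j k * w $ k) else 0)"
        by (intro sum.cong) (auto simp: axis_def)
      moreover have "(\<Sum>j\<in>UNIV. \<Sum>k\<in>UNIV. ?G i j k * (w $ j * axis i 1 $ k)) =
          (\<Sum>j\<in>UNIV. \<Sum>k\<in>UNIV. if k = i then ?G i j k * w $ j else 0)"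
        by (intro sum.cong) (auto simp: axis_def)
      ultimately show ?thesis
        by (simp add: distrib_left sum.distrib)
    qed
    then show ?thesis by (simp only: vertical sum_negf)
  qed
  also have "\<dots> = - (\<Sum>k\<in>UNIV. ((\<Sum>i\<in>UNIV. ?G i i k) + (\<Sum>i\<in>UNIV. ?G i k i)) * w $ k)"
  proof -
    have "(\<Sum>i\<in>UNIV. \<Sum>k\<in>UNIV. ?G i i k * w $ k) = (\<Sum>k\<in>UNIV. \<Sum>i\<in>UNIV. ?G i i k * w $ k)"
      and "(\<Sum>i\<in>UNIV. \<Sum>k\<in>UNIV. ?G i k i * w $ k) = (\<Sum>k\<in>UNIV. \<Sum>i\<in>UNIV. ?G i k i * w $ k)"
      by (rule sum.swap)+
    then show ?thesis
      by (simp add: sum.distrib distrib_right sum_distrib_right)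
  qed
  finally show ?thesis .
qed


section \<open>The Lie derivative of a volume with basic density\<close>

lemma weighted_metric_volume_coordinates:
  assumes M: "smooth_manifold M" and \<Omega>: "metric_volume M g \<Omega>" and c: "c \<in> atlas M"
    and z: "z \<in> coords c ` cdom c \<times> UNIV"
  shows "form_in (tangent_bundle M) (tangent_chart M c)
      (\<lambda>q ws. (\<rho> \<circ> bundle_proj) q * \<Omega> q ws) z b =
    (\<rho> \<circ> cinv c) (fst z) * det (metric_matrix M g c (cinv c (fst z))) * coord_det b"
proof -
  note MA = smooth_manifold_imp_diff_atlas[OF M] and TA = diff_atlas_tangent_bundle[OF M]
  obtain p w where p: "z = (coords c p, w)" "p \<in> cdom c" using z by auto
  define q where "q = cinv (tangent_chart M c) z"
  have q: "q = (p, tangent_of M c p w)"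
    using p c MA by (simp add: q_def cinv_tangent_chart cinv_coords)
  have qc: "q \<in> cdom (tangent_chart M c)"
    using p c MA by (simp add: q tangent_of_in_tangent_space)
  have tc: "tangent_chart M c \<in> atlas (tangent_bundle M)" using c by simp
  define ws where "ws = (\<lambda>i. tangent_of (tangent_bundle M) (tangent_chart M c) q (b i))"
  have "ws i \<in> tangent_space (tangent_bundle M) q" for i
    unfolding ws_def by (rule tangent_of_in_tangent_space[OF TA tc qc])
  then have "\<Omega> q ws = det (metric_matrix M g c (bundle_proj q)) *
      det (\<chi> a i. coord_covector a (ws i (tangent_chart M c)))"
    using \<Omega> c qc unfolding metric_volume_def by blast
  then have "\<Omega> q ws = det (metric_matrix M g c p) * coord_det b"
    using TA tc qc by (simp add: ws_def coord_det_def) (simp add: q bundle_proj_def)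
  then show ?thesis
    using p c MA unfolding form_in_def q_def[symmetric] ws_def[symmetric]
    by (simp add: q bundle_proj_def cinv_coords)
qed

text \<open>With \<open>h = \<rho> det g\<close>, the Lie derivative has the coefficient \<open>dh(v) + h div X\<close>.  The derivative of
  \<open>det g\<close> contributes \<open>2 \<Gamma>\<^sup>i\<^sub>k\<^sub>i v\<^sup>k\<close> and the divergence \<open>- (\<Gamma>\<^sup>i\<^sub>i\<^sub>k + \<Gamma>\<^sup>i\<^sub>k\<^sub>i) v\<^sup>k\<close>, both times \<open>h\<close>, and their sum is
  the torsion trace at \<open>v\<close>.\<close>

lemma lie_derivative_weighted_metric_volume:
  fixes M :: "('p, real^'n) manifold"
  assumes M: "smooth_manifold M" and g: "riemannian_metric M g" "affine_connection M D"
      "metric_compatible M g D"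
    and X: "geodesic_spray M D X" and \<Omega>: "metric_volume M g \<Omega>"
    and \<rho>: "smooth_fun M (topspace (mtop M)) \<rho>"
    and c: "c \<in> atlas M" "p \<in> cdom c" and v: "v \<in> tangent_space M p"
  shows "lie_derivative (tangent_bundle M) (tangent_chart M c) X
      (\<lambda>q ws. (\<rho> \<circ> bundle_proj) q * \<Omega> q ws) (p, v) ws =
    (diff_in c \<rho> p v + \<rho> p * (\<Sum>k\<in>UNIV. torsion_trace M D c p $ k * v c $ k)) *
      det (metric_matrix M g c p) * coord_det (\<lambda>i. ws i (tangent_chart M c))"
proof -
  note MA = smooth_manifold_imp_diff_atlas[OF M]
  let ?T = "tangent_chart M c" and ?TM = "tangent_bundle M"
  let ?\<mu> = "\<lambda>q ws. (\<rho> \<circ> bundle_proj) q * \<Omega> q ws"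
  let ?Xc = "\<lambda>z. X (cinv ?T z) ?T" and ?S = "coords c ` cdom c \<times> (UNIV :: (real^'n) set)"
  define y where "y = (coords c p, v c)"
  define b where "b = (\<lambda>i. ws i ?T)"
  define G where "G = (\<lambda>q. det (metric_matrix M g c q))"
  define a1 a2 where "a1 = (\<lambda>k. \<Sum>i\<in>UNIV. christoffel M D c i i k p)"
    and "a2 = (\<lambda>k. \<Sum>i\<in>UNIV. christoffel M D c i k i p)"
  have y: "y \<in> ?S" using c by (auto simp: y_def)
  have cp: "cinv c (coords c p) = p" by (rule cinv_coords[OF MA c])
  have form: "form_in ?TM ?T ?\<mu> z b = (\<rho> \<circ> cinv c) (fst z) * G (cinv c (fst z)) * coord_det b"
    if "z \<in> ?S" for z b
    unfolding G_def by (rule weighted_metric_volume_coordinates[OF M \<Omega> c(1) that])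
  obtain A where A: "(?Xc has_derivative A) (at y)"
    using spray_coordinates_differentiable[OF M X c] unfolding y_def differentiable_def by blast
  note A_eq = frechet_derivative_at[OF A, symmetric]
  have Xy: "fst (?Xc y) = v c"
    unfolding y_def by (simp add: spray_coordinates[OF MA X c])
  \<comment> \<open>The coefficient of the form depends on the base coordinates only.\<close>
  have "((\<rho> \<circ> cinv c) has_derivative frechet_derivative (\<rho> \<circ> cinv c) (at (coords c p))) (at (coords c p))"
    using smooth_on_differentiable[OF smooth_fun_chart[OF M c(1) \<rho>]] c
    by (simp add: frechet_derivative_works)
  from has_derivative_mult[OF this det_metric_has_derivative[OF M g c]]
  have h: "((\<lambda>x. (\<rho> \<circ> cinv c) x * G (cinv c x)) has_derivative
      (\<lambda>u. \<rho> p * (2 * (\<Sum>k\<in>UNIV. a2 k * u $ k) * G p) +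
        frechet_derivative (\<rho> \<circ> cinv c) (at (coords c p)) u * G p)) (at (coords c p))"
    by (simp add: G_def a2_def cp)
  have "((\<lambda>z. (\<rho> \<circ> cinv c) (fst z) * G (cinv c (fst z)) * coord_det b) has_derivative
      (\<lambda>u. (\<rho> p * (2 * (\<Sum>k\<in>UNIV. a2 k * fst u $ k) * G p) +
        frechet_derivative (\<rho> \<circ> cinv c) (at (coords c p)) (fst u) * G p) * coord_det b)) (at y)"
    by (intro has_derivative_mult_left has_derivative_compose[OF
          bounded_linear_imp_has_derivative[OF bounded_linear_fst]]) (use h in \<open>simp add: y_def o_def\<close>)
  then have "((\<lambda>z. form_in ?TM ?T ?\<mu> z b) has_derivative
      (\<lambda>u. (\<rho> p * (2 * (\<Sum>k\<in>UNIV. a2 k * fst u $ k) * G p) +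
        frechet_derivative (\<rho> \<circ> cinv c) (at (coords c p)) (fst u) * G p) * coord_det b)) (at y)"
    by (rule has_derivative_transform_within_open[OF _ _ y])
       (use open_chart_image[OF MA c(1)] form in \<open>auto simp: open_Times\<close>)
  from frechet_derivative_at[OF this, symmetric]
  have transport: "frechet_derivative (\<lambda>z. form_in ?TM ?T ?\<mu> z b) (at y) (?Xc y) =
      (\<rho> p * (2 * (\<Sum>k\<in>UNIV. a2 k * v c $ k) * G p) + diff_in c \<rho> p v * G p) * coord_det b"
    by (simp add: Xy diff_in_def)
  have "(\<Sum>i\<in>UNIV. form_in ?TM ?T ?\<mu> y (b(i := A (b i)))) =
      \<rho> p * G p * (\<Sum>i\<in>UNIV. coord_det (b(i := A (b i))))"
    using form[OF y] by (simp add: y_def cp sum_distrib_left)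
  also have "\<dots> = - \<rho> p * G p * (\<Sum>k\<in>UNIV. (a1 k + a2 k) * v c $ k) * coord_det b"
    using spray_divergence[OF M X c A[unfolded y_def]] has_derivative_linear[OF A]
    by (simp add: sum_coord_det_replace a1_def a2_def)
  finally have div: "(\<Sum>i\<in>UNIV. form_in ?TM ?T ?\<mu> y (b(i := A (b i)))) =
      - \<rho> p * G p * (\<Sum>k\<in>UNIV. (a1 k + a2 k) * v c $ k) * coord_det b" .
  have trace: "(\<Sum>k\<in>UNIV. torsion_trace M D c p $ k * v c $ k) =
      (\<Sum>k\<in>UNIV. a2 k * v c $ k) - (\<Sum>k\<in>UNIV. a1 k * v c $ k)"
    by (simp add: torsion_trace_def torsion_def a1_def a2_def sum_subtractf left_diff_distrib)
  have "lie_derivative ?TM ?T X ?\<mu> (p, v) ws =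
      frechet_derivative (\<lambda>z. form_in ?TM ?T ?\<mu> z b) (at y) (?Xc y) +
      (\<Sum>i\<in>UNIV. form_in ?TM ?T ?\<mu> y (b(i := A (b i))))"
    unfolding lie_derivative_def Let_def tangent_chart_simps y_def[symmetric] A_eq b_def ..
  then show ?thesis
    unfolding transport div trace b_def[symmetric]
    by (simp add: G_def distrib_right sum.distrib algebra_simps)
qed

lemma volume_form_weighted_metric_volume:
  fixes M :: "('p, real^'n) manifold"
  assumes M: "smooth_manifold M" and \<Omega>: "metric_volume M g \<Omega>"
    and \<rho>: "smooth_fun M (topspace (mtop M)) \<rho>" and nonzero: "\<And>p. p \<in> topspace (mtop M) \<Longrightarrow> \<rho> p \<noteq> 0"
  shows "volume_form (tangent_bundle M) (\<lambda>q ws. (\<rho> \<circ> bundle_proj) q * \<Omega> q ws)"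
proof -
  let ?TM = "tangent_bundle M" and ?\<mu> = "\<lambda>q ws. (\<rho> \<circ> bundle_proj) q * \<Omega> q ws"
  note MA = smooth_manifold_imp_diff_atlas[OF M]
  have vol: "volume_form ?TM \<Omega>" using \<Omega> by (simp add: metric_volume_def)
  have smooth: "smooth_on (\<lambda>z. form_in ?TM (tangent_chart M c) ?\<mu> z b)
      (coords (tangent_chart M c) ` cdom (tangent_chart M c))" if c: "c \<in> atlas M" for c b
    unfolding tangent_chart_image_whole[OF MA c]
  proof (rule smooth_on_cong)
    show "smooth_on (\<lambda>z. (\<rho> \<circ> cinv c) (fst z) * form_in ?TM (tangent_chart M c) \<Omega> z b)
        (coords c ` cdom c \<times> UNIV)"
      by (intro smooth_on_mult smooth_on_fst smooth_fun_chart[OF M c \<rho>])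
         (use vol c in \<open>auto simp: volume_form_def differential_form_def
            tangent_chart_image_whole[OF MA c, symmetric]\<close>)
    show "(\<rho> \<circ> cinv c) (fst z) * form_in ?TM (tangent_chart M c) \<Omega> z b =
        form_in ?TM (tangent_chart M c) ?\<mu> z b" if "z \<in> coords c ` cdom c \<times> UNIV" for z
      using that by (cases z) (simp add: form_in_def cinv_tangent_chart[OF MA c] bundle_proj_def)
  qed
  have "differential_form ?TM ?\<mu>"
    unfolding differential_form_def
  proof (intro conjI ballI allI impI)
    fix q i a u v and ws :: "'n + 'n \<Rightarrow> _"
    assume *: "q \<in> topspace (mtop ?TM)" "\<forall>i. ws i \<in> tangent_space ?TM q"
      "u \<in> tangent_space ?TM q" "v \<in> tangent_space ?TM q"
    have "\<Omega> q (ws(i := \<lambda>c. a *\<^sub>R u c + v c)) = a * \<Omega> q (ws(i := u)) + \<Omega> q (ws(i := v))"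
      using vol * unfolding volume_form_def differential_form_def by blast
    then show "?\<mu> q (ws(i := \<lambda>c. a *\<^sub>R u c + v c)) = a * ?\<mu> q (ws(i := u)) + ?\<mu> q (ws(i := v))"
      by (simp add: algebra_simps)
  next
    fix q i j and ws :: "'n + 'n \<Rightarrow> _"
    assume *: "q \<in> topspace (mtop ?TM)" "\<forall>i. ws i \<in> tangent_space ?TM q" "i \<noteq> j \<and> ws i = ws j"
    have "\<Omega> q ws = 0"
      using vol * unfolding volume_form_def differential_form_def by blast
    then show "?\<mu> q ws = 0" by simp
  qed (use smooth in auto)
  moreover have "\<exists>ws. (\<forall>i. ws i \<in> tangent_space ?TM q) \<and> ?\<mu> q ws \<noteq> 0"
    if q: "q \<in> topspace (mtop ?TM)" for q
  proof -
    have "\<rho> (bundle_proj q) \<noteq> 0"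
      using q nonzero by (auto simp: topspace_tangent_bundle[OF M] bundle_proj_def)
    then show ?thesis
      using vol q by (simp add: volume_form_def)
  qed
  ultimately show ?thesis
    using vol unfolding volume_form_def by blast
qed

text \<open>\<open>\<Omega>\<close> is a volume form, so it is nonzero on some vectors at every point, and \<open>det g\<close> is one of its
  factors there.\<close>

lemma det_metric_matrix_nonzero:
  assumes M: "smooth_manifold M" and \<Omega>: "metric_volume M g \<Omega>"
    and c: "c \<in> atlas M" "p \<in> cdom c" and v: "v \<in> tangent_space M p"
  shows "det (metric_matrix M g c p) \<noteq> 0"
proof -
  have q: "(p, v) \<in> cdom (tangent_chart M c)" using c v by simp
  then have "(p, v) \<in> topspace (mtop (tangent_bundle M))"
    using tangent_chart_subset_topspace[OF M c(1)] by blast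
  then obtain ws where "\<And>i. ws i \<in> tangent_space (tangent_bundle M) (p, v)" "\<Omega> (p, v) ws \<noteq> 0"
    using \<Omega> unfolding metric_volume_def volume_form_def by blast
  moreover from this(1) have "\<Omega> (p, v) ws = det (metric_matrix M g c (bundle_proj (p, v))) *
      det (\<chi> a i. coord_covector a (ws i (tangent_chart M c)))"
    using \<Omega> c(1) q unfolding metric_volume_def by blast
  ultimately show ?thesis by (auto simp: bundle_proj_def)
qed

text \<open>The Lie derivative at \<open>(p, v)\<close> is \<open>(d\<rho> + \<rho> tr T)(v)\<close> times \<open>\<Omega>\<close>, and \<open>\<Omega>\<close> is nonzero on the basis of
  coordinate vectors.  Since the point \<open>v\<close> of the fibre is arbitrary, the vanishing of this one
  coefficient on the tangent bundle is an identity of one-forms on the base.\<close>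

lemma invariant_iff_torsion_trace:
  fixes M :: "('p, real^'n) manifold"
  assumes M: "smooth_manifold M" and g: "riemannian_metric M g" "affine_connection M D"
      "metric_compatible M g D"
    and X: "geodesic_spray M D X" and \<Omega>: "metric_volume M g \<Omega>"
    and \<rho>: "smooth_fun M (topspace (mtop M)) \<rho>" and nonzero: "\<And>p. p \<in> topspace (mtop M) \<Longrightarrow> \<rho> p \<noteq> 0"
  shows "invariant_volume (tangent_bundle M) X (\<lambda>q ws. (\<rho> \<circ> bundle_proj) q * \<Omega> q ws) \<longleftrightarrow>
    (\<forall>c\<in>atlas M. \<forall>p\<in>cdom c. \<forall>v\<in>tangent_space M p.
      diff_in c \<rho> p v = - \<rho> p * (\<Sum>k\<in>UNIV. torsion_trace M D c p $ k * v c $ k))"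
    (is "?inv \<longleftrightarrow> ?eq")
proof
  note lie = lie_derivative_weighted_metric_volume[OF M g X \<Omega> \<rho>]
  note TA = diff_atlas_tangent_bundle[OF M]
  {
    assume inv: ?inv
    show ?eq
    proof (intro ballI)
      fix c p v assume c: "c \<in> atlas M" "p \<in> cdom c" and v: "v \<in> tangent_space M p"
      \<comment> \<open>On the coordinate basis the determinant factor of the Lie derivative is 1.\<close>
      define ws where "ws = (\<lambda>i. tangent_of (tangent_bundle M) (tangent_chart M c) (p, v) (coord_vector i))"
      have tc: "tangent_chart M c \<in> atlas (tangent_bundle M)" "(p, v) \<in> cdom (tangent_chart M c)"
        using c v by auto
      have "ws i \<in> tangent_space (tangent_bundle M) (p, v)" for i
        unfolding ws_def by (rule tangent_of_in_tangent_space[OF TA tc])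
      then have "lie_derivative (tangent_bundle M) (tangent_chart M c) X
          (\<lambda>q ws. (\<rho> \<circ> bundle_proj) q * \<Omega> q ws) (p, v) ws = 0"
        using inv tc unfolding invariant_volume_def by blast
      moreover have "(\<lambda>i. ws i (tangent_chart M c)) = coord_vector"
        using tangent_of_own_chart[OF TA tc] by (auto simp: ws_def)
      ultimately show "diff_in c \<rho> p v = - \<rho> p * (\<Sum>k\<in>UNIV. torsion_trace M D c p $ k * v c $ k)"
        using det_metric_matrix_nonzero[OF M \<Omega> c v]
        unfolding lie[OF c v] by (simp add: coord_det_coord_vector)
    qed
  }
  assume eq: ?eq
  have "lie_derivative (tangent_bundle M) (tangent_chart M c) X
      (\<lambda>q ws. (\<rho> \<circ> bundle_proj) q * \<Omega> q ws) (p, v) ws = 0"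
    if "c \<in> atlas M" "p \<in> cdom c" "v \<in> tangent_space M p" for c p v ws
    using eq that unfolding lie[OF that] by simp
  then show ?inv
    unfolding invariant_volume_def using volume_form_weighted_metric_volume[OF M \<Omega> \<rho> nonzero] by auto
qed

section \<open>Invariant densities and exactness\<close>

lemma smooth_fun_compose:
  assumes "smooth_manifold M" "smooth_on h T" "smooth_fun M (topspace (mtop M)) f"
    and "\<And>p. p \<in> topspace (mtop M) \<Longrightarrow> f p \<in> T"
  shows "smooth_fun M (topspace (mtop M)) (\<lambda>p. h (f p))"
  unfolding smooth_fun_def
proof
  fix c assume c: "c \<in> atlas M"
  have dom: "cdom c \<inter> topspace (mtop M) = cdom c"
    using chart_subset_topspace[OF assms(1) c] by blast
  have "smooth_on (\<lambda>x. h ((f \<circ> cinv c) x)) (coords c ` cdom c)"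
    by (rule smooth_on_compose[OF assms(2) smooth_fun_chart[OF assms(1) c assms(3)]])
       (use assms(4) chart_subset_topspace[OF assms(1) c] in
         \<open>auto simp: cinv_coords[OF smooth_manifold_imp_diff_atlas[OF assms(1)] c]\<close>)
  then show "smooth_on ((\<lambda>p. h (f p)) \<circ> cinv c) (coords c ` (cdom c \<inter> topspace (mtop M)))"
    by (simp add: dom o_def)
qed

lemma diff_in_compose:
  assumes M: "smooth_manifold M" and c: "c \<in> atlas M" "p \<in> cdom c"
    and f: "smooth_fun M (topspace (mtop M)) f"
    and h: "(h has_real_derivative h') (at (f p))"
  shows "diff_in c (\<lambda>p. h (f p)) p v = h' * diff_in c f p v"
proof -
  have cp: "cinv c (coords c p) = p"
    by (rule cinv_coords[OF smooth_manifold_imp_diff_atlas[OF M] c])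
  have "((f \<circ> cinv c) has_derivative frechet_derivative (f \<circ> cinv c) (at (coords c p))) (at (coords c p))"
    using smooth_on_differentiable[OF smooth_fun_chart[OF M c(1) f]] c
    by (simp add: frechet_derivative_works)
  from has_derivative_compose[OF this, of h "\<lambda>t. h' * t"] h
  have "(((\<lambda>p. h (f p)) \<circ> cinv c) has_derivative
      (\<lambda>v. h' * frechet_derivative (f \<circ> cinv c) (at (coords c p)) v)) (at (coords c p))"
    by (simp add: has_field_derivative_def o_def cp)
  from frechet_derivative_at[OF this, symmetric] show ?thesis
    by (simp add: diff_in_def)
qed

theorem theorem6p2:
  fixes Q :: "('p, real^'n) manifold"
    and g :: "'p \<Rightarrow> ('p, real^'n) tvec \<Rightarrow> ('p, real^'n) tvec \<Rightarrow> real"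
    and D :: "('p, real^'n) connection"
    and X :: "(('p, real^'n) tpoint, (real^'n) \<times> (real^'n)) vfield"
    and \<Omega> :: "(('p, real^'n) tpoint, (real^'n) \<times> (real^'n), 'n + 'n) dform"
  assumes "smooth_manifold Q"
    and "riemannian_metric Q g"
    and "affine_connection Q D"
    and "metric_compatible Q g D"
    and "geodesic_spray Q D X"
    and "metric_volume Q g \<Omega>"
  shows "(\<exists>\<rho>. smooth_fun Q (topspace (mtop Q)) \<rho> \<and>
              (\<forall>p\<in>topspace (mtop Q). \<rho> p > 0) \<and>
              invariant_volume (tangent_bundle Q) X (\<lambda>q ws. (\<rho> \<circ> bundle_proj) q * \<Omega> q ws))
         \<longleftrightarrow> exact_one_form Q (torsion_trace Q D)"
proof
  note M = assms(1)
  note invariant = invariant_iff_torsion_trace[OF assms]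
  {
    assume "\<exists>\<rho>. smooth_fun Q (topspace (mtop Q)) \<rho> \<and>
              (\<forall>p\<in>topspace (mtop Q). \<rho> p > 0) \<and>
              invariant_volume (tangent_bundle Q) X (\<lambda>q ws. (\<rho> \<circ> bundle_proj) q * \<Omega> q ws)"
    then obtain \<rho> where \<rho>: "smooth_fun Q (topspace (mtop Q)) \<rho>"
      and pos: "\<And>p. p \<in> topspace (mtop Q) \<Longrightarrow> \<rho> p > 0"
      and inv: "invariant_volume (tangent_bundle Q) X (\<lambda>q ws. (\<rho> \<circ> bundle_proj) q * \<Omega> q ws)"
      by blast
    have nz: "\<rho> p \<noteq> 0" if "p \<in> topspace (mtop Q)" for p
      using pos[OF that] by simp
    \<comment> \<open>Dividing \<open>d\<rho> = - \<rho> tr T\<close> by \<open>\<rho>\<close> exhibits \<open>- ln \<rho>\<close> as a primitive.\<close>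
    note eq = iffD1[OF invariant[OF \<rho> nz] inv]
    have "smooth_on (\<lambda>t::real. - ln t) {0<..}"
      using smooth_on_linear[OF bounded_linear_minus[OF bounded_linear_ident] smooth_on_ln] by simp
    then have smooth: "smooth_fun Q (topspace (mtop Q)) (\<lambda>p. - ln (\<rho> p))"
      by (rule smooth_fun_compose[OF M _ \<rho>]) (simp add: pos)
    have "diff_in c (\<lambda>p. - ln (\<rho> p)) p v = (\<Sum>k\<in>UNIV. torsion_trace Q D c p $ k * v c $ k)"
      if c: "c \<in> atlas Q" "p \<in> cdom c" and v: "v \<in> tangent_space Q p" for c p v
    proof -
      have p: "\<rho> p > 0"
        using pos chart_subset_topspace[OF M c(1)] c(2) by blast
      then have "((\<lambda>t. - ln t) has_real_derivative - inverse (\<rho> p)) (at (\<rho> p))"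
        by (auto intro!: derivative_eq_intros simp: divide_inverse)
      from diff_in_compose[OF M c \<rho> this, of v] p show ?thesis
        using eq c v by simp
    qed
    with smooth show "exact_one_form Q (torsion_trace Q D)"
      unfolding exact_one_form_def by blast
  }
  assume "exact_one_form Q (torsion_trace Q D)"
  then obtain f where f: "smooth_fun Q (topspace (mtop Q)) f"
    and df: "\<And>c p v. c \<in> atlas Q \<Longrightarrow> p \<in> cdom c \<Longrightarrow> v \<in> tangent_space Q p \<Longrightarrow>
      diff_in c f p v = (\<Sum>k\<in>UNIV. torsion_trace Q D c p $ k * v c $ k)"
    unfolding exact_one_form_def by blast
  \<comment> \<open>A primitive \<open>f\<close> of the torsion trace gives a solution of \<open>d\<rho> = - \<rho> tr T\<close>.\<close>
  define \<rho> where "\<rho> = (\<lambda>p. exp (- f p))"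
  have "smooth_fun Q (topspace (mtop Q)) (\<lambda>p. exp (- f p))"
  proof (rule smooth_fun_compose[OF M _ f])
    have "smooth_on (\<lambda>t::real. t) UNIV"
      by (simp add: smooth_on_def Ck_on_ident)
    then have "smooth_on (\<lambda>t::real. - t) UNIV"
      by (rule smooth_on_linear[OF bounded_linear_minus[OF bounded_linear_ident]])
    from smooth_on_compose[OF smooth_on_exp this]
    show "smooth_on (\<lambda>t::real. exp (- t)) UNIV" by simp
  qed simp
  then have \<rho>: "smooth_fun Q (topspace (mtop Q)) \<rho>" by (simp add: \<rho>_def)
  have "diff_in c \<rho> p v = - \<rho> p * (\<Sum>k\<in>UNIV. torsion_trace Q D c p $ k * v c $ k)"
    if c: "c \<in> atlas Q" "p \<in> cdom c" and v: "v \<in> tangent_space Q p" for c p v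
  proof -
    have "((\<lambda>t. exp (- t)) has_real_derivative - exp (- f p)) (at (f p))"
      by (auto intro!: derivative_eq_intros)
    from diff_in_compose[OF M c f this, of v] show ?thesis
      by (simp add: \<rho>_def df[OF c v])
  qed
  then have "invariant_volume (tangent_bundle Q) X (\<lambda>q ws. (\<rho> \<circ> bundle_proj) q * \<Omega> q ws)"
    by (intro iffD2[OF invariant[OF \<rho>]] ballI) (auto simp: \<rho>_def)
  with \<rho> show "\<exists>\<rho>. smooth_fun Q (topspace (mtop Q)) \<rho> \<and>
              (\<forall>p\<in>topspace (mtop Q). \<rho> p > 0) \<and>
              invariant_volume (tangent_bundle Q) X (\<lambda>q ws. (\<rho> \<circ> bundle_proj) q * \<Omega> q ws)"
    by (intro exI[of _ \<rho>]) (auto simp: \<rho>_def)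
qed

end
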